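(* Let $A$, $B$, $B'$, $C$, $C'$, $C-B$, $C'-B'$ and $\mathbb{X}$ be positive stable matrices in $\mathbb{C}^{r\times r}$ such that $B$, $B'$, $C$, $C'$ and $\mathbb{X}$ commute with each other. Then the extended Appell matrix function $F_{2}(A,B,B';C,C';z,w;\mathbb{X})$ of the complex variables $z,w$ has the following integral representation: $$F_{2}(A,B,B';C,C';z,w;\mathbb{X})=\left(\int_{0}^{1}\!\!\int_{0}^{1}(1-zu-wv)^{-A}u^{B-I}(1-u)^{C-B-I}v^{B'-I}(1-v)^{C'-B'-I}\exp\Big(\frac{-\mathbb{X}}{u(1-u)}-\frac{\mathbb{X}}{v(1-v)}\Big)du\,dv\right)G,$$ where $G=\Gamma(C)\Gamma(C')\Gamma^{-1}(B)\Gamma^{-1}(B')\Gamma^{-1}(C-B)\Gamma^{-1}(C'-B')$.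
   Context: $\mathbb{C}^{r\times r}$ is the space of complex $r\times r$ matrices and $I$ is the identity. A matrix is positive stable if all its eigenvalues have positive real part. Matrix powers are $t^{M}=\exp(M\log t)$; in particular $(1-s)^{-M}=\sum_{n\ge0}(M)_n\frac{s^n}{n!}$ for $|s|<1$. For positive stable $M$, $\Gamma(M)=\int_0^\infty e^{-t}t^{M-I}dt$, and $\Gamma^{-1}(M)$ is its inverse. The Pochhammer symbol is $(M)_0=I$, $(M)_n=M(M+I)\cdots(M+(n-1)I)$ for $n\ge1$. Extended beta matrix function: for commuting positive stable matrices $P,Q,\mathbb{X}$, $$\mathfrak{B}(P,Q;\mathbb{X})=\int_0^1 t^{P-I}(1-t)^{Q-I}\exp\Big(\frac{-\mathbb{X}}{t(1-t)}\Big)dt.$$ Extended Appell matrix function $F_2$ (under the matrix hypotheses of the claim; the order of the factors matters): $$F_{2}(A,B,B';C,C';z,w;\mathbb{X})=\left(\sum_{m,n\ge0}(A)_{m+n}\,\mathfrak{B}(B+mI,C-B;\mathbb{X})\,\mathfrak{B}(B'+nI,C'-B';\mathbb{X})\frac{z^mw^n}{m!\,n!}\right)\Gamma(C)\Gamma(C')\Gamma^{-1}(B)\Gamma^{-1}(B')\Gamma^{-1}(C-B)\Gamma^{-1}(C'-B').$$ *)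

theory Defs
  imports "HOL-Analysis.Analysis"
begin

(* The product of square matrices is **; the library's * (and hence ^ and exp) on the type
   complex^'r^'r is entrywise, so powers and the exponential are defined here. *)

type_synonym 'r cmat = "complex ^ 'r ^ 'r"

definition cscale :: "complex \<Rightarrow> 'r::finite cmat \<Rightarrow> 'r cmat"  (infixr \<open>*\<^sub>M\<close> 75)
  where "c *\<^sub>M M = map_matrix (\<lambda>x. c * x) M"

primrec mpow :: "'r::finite cmat \<Rightarrow> nat \<Rightarrow> 'r cmat" where
  "mpow M 0 = mat 1"
| "mpow M (Suc n) = mpow M n ** M"

definition mexp :: "'r::finite cmat \<Rightarrow> 'r cmat"
  where "mexp M = (\<Sum>n. (1 / fact n) *\<^sub>R mpow M n)"

(* For s \<noteq> 0, s^M = exp (M log s), with the principal branch of the logarithm. *)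
definition mcpow :: "complex \<Rightarrow> 'r::finite cmat \<Rightarrow> 'r cmat"
  where "mcpow s M = mexp (Ln s *\<^sub>M M)"

definition is_eigenvalue :: "'r::finite cmat \<Rightarrow> complex \<Rightarrow> bool"
  where "is_eigenvalue M \<mu> \<longleftrightarrow> (\<exists>x. x \<noteq> 0 \<and> M *v x = \<mu> *s x)"

definition positive_stable :: "'r::finite cmat \<Rightarrow> bool"
  where "positive_stable M \<longleftrightarrow> (\<forall>\<mu>. is_eigenvalue M \<mu> \<longrightarrow> 0 < Re \<mu>)"

definition mcommute :: "'r::finite cmat \<Rightarrow> 'r cmat \<Rightarrow> bool"
  where "mcommute M N \<longleftrightarrow> M ** N = N ** M"

primrec mpochhammer :: "'r::finite cmat \<Rightarrow> nat \<Rightarrow> 'r cmat" where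
  "mpochhammer M 0 = mat 1"
| "mpochhammer M (Suc n) = mpochhammer M n ** (M + mat (of_nat n))"

definition mGamma :: "'r::finite cmat \<Rightarrow> 'r cmat"
  where "mGamma M =
    (LINT t:{0<..}|lborel. exp (-t) *\<^sub>R mcpow (complex_of_real t) (M - mat 1))"

definition ext_mBeta :: "'r::finite cmat \<Rightarrow> 'r cmat \<Rightarrow> 'r cmat \<Rightarrow> 'r cmat"
  where "ext_mBeta P Q X =
    (LINT t:{0<..<1}|lborel.
       mcpow (complex_of_real t) (P - mat 1) ** mcpow (complex_of_real (1 - t)) (Q - mat 1)
       ** mexp (- ((1 / (t * (1 - t))) *\<^sub>R X)))"

definition appell_factor ::
    "'r::finite cmat \<Rightarrow> 'r cmat \<Rightarrow> 'r cmat \<Rightarrow> 'r cmat \<Rightarrow> 'r cmat"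
  where "appell_factor B B' C C' =
    mGamma C ** mGamma C' ** matrix_inv (mGamma B) ** matrix_inv (mGamma B')
    ** matrix_inv (mGamma (C - B)) ** matrix_inv (mGamma (C' - B'))"

definition ext_F2_term ::
    "'r::finite cmat \<Rightarrow> 'r cmat \<Rightarrow> 'r cmat \<Rightarrow> 'r cmat \<Rightarrow> 'r cmat \<Rightarrow>
     complex \<Rightarrow> complex \<Rightarrow> 'r cmat \<Rightarrow> nat \<times> nat \<Rightarrow> 'r cmat"
  where "ext_F2_term A B B' C C' z w X = (\<lambda>(m, n).
    (z ^ m * w ^ n / (fact m * fact n)) *\<^sub>M
      (mpochhammer A (m + n) ** ext_mBeta (B + mat (of_nat m)) (C - B) X
       ** ext_mBeta (B' + mat (of_nat n)) (C' - B') X))"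

definition ext_F2 ::
    "'r::finite cmat \<Rightarrow> 'r cmat \<Rightarrow> 'r cmat \<Rightarrow> 'r cmat \<Rightarrow> 'r cmat \<Rightarrow>
     complex \<Rightarrow> complex \<Rightarrow> 'r cmat \<Rightarrow> 'r cmat"
  where "ext_F2 A B B' C C' z w X =
    (\<Sum>\<^sub>\<infinity>p. ext_F2_term A B B' C C' z w X p) ** appell_factor B B' C C'"

end

theory Submission
  imports Defs "HOL-Computational_Algebra.Fundamental_Theorem_Algebra"
begin

text \<open>The series \<open>\<Sum> (A)\<^sub>m\<^sub>+\<^sub>n x\<^sup>m y\<^sup>n / (m! n!)\<close> converges absolutely to \<open>(1 - x - y)\<^sup>-\<^sup>A\<close> for
  \<open>|x| + |y| < 1\<close>, and its absolute sum is at most a multiple of \<open>(1 - |x| - |y|) powr (- \<parallel>A\<parallel>)\<close>.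
  For \<open>x = z u\<close>, \<open>y = w v\<close> with \<open>|z| + |w| \<le> 1\<close> this is dominated by
  \<open>((1 - u) (1 - v)) powr (- \<parallel>A\<parallel>)\<close>. As \<open>X\<close> is positive stable, \<open>exp (- t X)\<close> decays exponentially, so
  the factors \<open>exp (- X / (u (1 - u)))\<close> and \<open>exp (- X / (v (1 - v)))\<close> outweigh this singularity and
  those of the matrix powers. All partial sums are thus bounded by one constant on the unit square, and
  the series can be integrated term by term, also in the boundary case \<open>|z| + |w| = 1\<close>.\<close>

section \<open>Matrix arithmetic\<close>

text \<open>The norm on nested vectors is the Frobenius norm. Row i of the product is a combination
  of the rows of \<open>B\<close> with coefficients from row i of \<open>A\<close>, so the triangle
  inequality and Cauchy-Schwarz bound that row, and the row bounds are combined in the L2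
  sense.\<close>

lemma norm_matrix_matrix_mult_le:
  fixes A :: "complex ^ 'n ^ 'm" and B :: "complex ^ 'p ^ 'n"
  shows "norm (A ** B) \<le> norm A * norm B"
proof -
  have row: "norm ((A ** B) $ i) \<le> norm (A $ i) * norm B" for i
  proof -
    have "(A ** B) $ i = (\<Sum>k\<in>UNIV. A $ i $ k *s B $ k)"
      by (simp add: vec_eq_iff matrix_matrix_mult_def)
    also have "norm \<dots> \<le> (\<Sum>k\<in>UNIV. norm (A $ i $ k *s B $ k))"
      by (rule norm_sum)
    also have "\<dots> = (\<Sum>k\<in>UNIV. \<bar>norm (A $ i $ k)\<bar> * \<bar>norm (B $ k)\<bar>)"
      by (simp add: norm_vec_def norm_mult L2_set_right_distrib)
    also have "\<dots> \<le> norm (A $ i) * norm B"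
      unfolding norm_vec_def[of "A $ i"] norm_vec_def[of B] by (rule L2_set_mult_ineq)
    finally show ?thesis .
  qed
  have "norm (A ** B) \<le> L2_set (\<lambda>i. norm (A $ i) * norm B) UNIV"
    unfolding norm_vec_def[of "A ** B"] by (rule L2_set_mono) (auto simp: row)
  also have "\<dots> = norm A * norm B"
    by (simp add: norm_vec_def[of A] L2_set_left_distrib)
  finally show ?thesis .
qed

lemma bounded_bilinear_matrix_matrix_mult [bounded_bilinear]:
  "bounded_bilinear ((**) :: complex ^ 'n ^ 'm \<Rightarrow> complex ^ 'p ^ 'n \<Rightarrow> complex ^ 'p ^ 'm)"
proof
  show "\<exists>K. \<forall>a b. norm ((a :: complex ^ 'n ^ 'm) ** (b :: complex ^ 'p ^ 'n)) \<le> norm a * norm b * K"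
    by (rule exI[of _ 1]) (simp add: norm_matrix_matrix_mult_le)
qed (simp_all add: vec_eq_iff matrix_matrix_mult_def sum.distrib sum_distrib_left scaleR_right.sum
      algebra_simps)

lemma cscale_nth [simp]: "(c *\<^sub>M M) $ i $ j = c * M $ i $ j"
  by (simp add: cscale_def map_matrix_def)

lemma norm_nth_nth_le: "cmod (M $ i $ j) \<le> norm M"
  by (rule order_trans[OF Finite_Cartesian_Product.norm_nth_le Finite_Cartesian_Product.norm_nth_le])

lemma norm_cscale: "norm (c *\<^sub>M M) = cmod c * norm M"
  by (simp add: norm_vec_def norm_mult L2_set_right_distrib)

lemma cscale_of_real: "complex_of_real c *\<^sub>M M = c *\<^sub>R M"
  by (simp add: vec_eq_iff scaleR_conv_of_real[where 'a = complex])

lemma bounded_linear_cscale: "bounded_linear ((*\<^sub>M) c)"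
  by (rule bounded_linear_intro[where K = "cmod c"])
    (auto simp: vec_eq_iff algebra_simps norm_cscale)

lemma cscale_simps [simp]:
  "1 *\<^sub>M M = M" "0 *\<^sub>M M = 0" "c *\<^sub>M 0 = 0" "c *\<^sub>M d *\<^sub>M M = (c * d) *\<^sub>M M"
  by (simp_all add: vec_eq_iff)

lemma cscale_distribs:
  "c *\<^sub>M (M + N) = c *\<^sub>M M + c *\<^sub>M N" "c *\<^sub>M (M - N) = c *\<^sub>M M - c *\<^sub>M N"
  "(c + d) *\<^sub>M M = c *\<^sub>M M + d *\<^sub>M M" "(c - d) *\<^sub>M M = c *\<^sub>M M - d *\<^sub>M M"
  "c *\<^sub>M (- M) = - (c *\<^sub>M M)" "(- c) *\<^sub>M M = - (c *\<^sub>M M)"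
  by (simp_all add: vec_eq_iff algebra_simps)

lemma cscale_mult_left [simp]: "(c *\<^sub>M M) ** N = c *\<^sub>M (M ** N)"
  by (simp add: vec_eq_iff matrix_matrix_mult_def sum_distrib_left algebra_simps)

lemma cscale_mult_right [simp]: "M ** (c *\<^sub>M N) = c *\<^sub>M (M ** N)"
  by (simp add: vec_eq_iff matrix_matrix_mult_def sum_distrib_left algebra_simps)

text \<open>Lets the \<open>cscale\<close> rules pull scalar matrices out of products. It is invoked
  in instances only, since as a rewrite rule it would apply to the \<open>mat 1\<close> on its own
  right-hand side.\<close>

lemma mat_conv_cscale: "mat c = c *\<^sub>M mat 1"
  by (simp add: vec_eq_iff mat_def)

lemma matrix_mult_minus_left: "(- M) ** N = - (M ** (N :: complex ^ 'n ^ 'n))"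
  using bounded_bilinear.minus_left[OF bounded_bilinear_matrix_matrix_mult] .

lemma matrix_mult_minus_right: "M ** (- N) = - (M ** (N :: complex ^ 'n ^ 'n))"
  using bounded_bilinear.minus_right[OF bounded_bilinear_matrix_matrix_mult] .

lemma matrix_mult_sum_left: "(\<Sum>k\<in>S. f k) ** N = (\<Sum>k\<in>S. f k ** (N :: complex ^ 'n ^ 'n))"
  using bounded_bilinear.sum_left[OF bounded_bilinear_matrix_matrix_mult] .

lemma matrix_mult_add_left: "(M + N) ** L = M ** L + N ** (L :: complex ^ 'n ^ 'n)"
  using bounded_bilinear.add_left[OF bounded_bilinear_matrix_matrix_mult] .

lemma mpow_commute: "M ** N = N ** M \<Longrightarrow> mpow M n ** N = N ** mpow M n"
proof (induction n)
  case (Suc n)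
  then have "mpow M n ** (M ** N) = N ** (mpow M n ** M)"
    by (simp add: matrix_mul_assoc)
  then show ?case by (simp add: matrix_mul_assoc)
qed simp

lemma mpow_cscale: "mpow (c *\<^sub>M M) n = c ^ n *\<^sub>M mpow M n"
  by (induction n) (simp_all add: mult.commute)

text \<open>The factor \<open>norm (mat 1)\<close> is the square root of the dimension: the
  Frobenius norm of the identity is not 1 in general. It is carried through the later
  bounds.\<close>

lemma norm_mpow_le: "norm (mpow M n) \<le> norm (mat 1 :: 'r::finite cmat) * norm (M :: 'r cmat) ^ n"
proof (induction n)
  case (Suc n)
  have "norm (mpow M (Suc n)) \<le> norm (mpow M n) * norm M"
    by (simp add: norm_matrix_matrix_mult_le)
  also have "\<dots> \<le> norm (mat 1 :: 'r cmat) * norm M ^ n * norm M"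
    by (intro mult_right_mono Suc) auto
  finally show ?case by (simp add: algebra_simps)
qed simp

section \<open>The matrix exponential\<close>

lemma norm_mexp_term_le:
  "norm ((1 / fact n) *\<^sub>R mpow M n) \<le> norm (mat 1 :: 'r::finite cmat) * (norm (M :: 'r cmat) ^ n /\<^sub>R fact n)"
  using norm_mpow_le[of M n] by (simp add: field_simps)

lemma mexp_sums: "(\<lambda>n. (1 / fact n) *\<^sub>R mpow (M :: 'r::finite cmat) n) sums mexp M"
proof -
  have "summable (\<lambda>n. norm (mat 1 :: 'r cmat) * (norm M ^ n /\<^sub>R fact n))"
    by (intro summable_mult summable_exp_generic)
  then have "summable (\<lambda>n. (1 / fact n) *\<^sub>R mpow M n)"
    by (rule summable_comparison_test'[where N = 0]) (rule norm_mexp_term_le)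
  then show ?thesis unfolding mexp_def by (rule summable_sums)
qed

lemma norm_mexp_le: "norm (mexp M) \<le> norm (mat 1 :: 'r::finite cmat) * exp (norm (M :: 'r cmat))"
proof -
  have s: "summable (\<lambda>n. norm (mat 1 :: 'r cmat) * (norm M ^ n /\<^sub>R fact n))"
    by (intro summable_mult summable_exp_generic)
  have "norm (mexp M) \<le> (\<Sum>n. norm (mat 1 :: 'r cmat) * (norm M ^ n /\<^sub>R fact n))"
    unfolding mexp_def by (rule norm_suminf_le[OF norm_mexp_term_le s])
  also have "\<dots> = norm (mat 1 :: 'r cmat) * exp (norm M)"
    unfolding exp_def by (intro suminf_mult summable_exp_generic)
  finally show ?thesis .
qed

text \<open>Each entry of exp(cM) is an ordinary power series in c, so termwise differentiation and
  uniqueness of sums are available from scalar analysis.\<close>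

lemma mexp_cscale_nth_sums:
  "(\<lambda>n. (mpow (M :: 'r::finite cmat) n $ i $ j / fact n) * c ^ n) sums (mexp (c *\<^sub>M M) $ i $ j)"
proof -
  have "bounded_linear (\<lambda>M :: 'r cmat. M $ i $ j)"
    by (intro bounded_linear_compose[OF bounded_linear_vec_nth] bounded_linear_vec_nth)
  from bounded_linear.sums[OF this mexp_sums[of "c *\<^sub>M M"]]
  show ?thesis
    by (simp add: mpow_cscale scaleR_conv_of_real[where 'a = complex] algebra_simps)
qed

text \<open>Taken entry by entry, so that the rules for \<open>has_field_derivative\<close>, which
  concerns field-valued functions, apply to each entry.\<close>

definition has_matrix_derivative ::
    "(complex \<Rightarrow> 'r::finite cmat) \<Rightarrow> 'r cmat \<Rightarrow> complex \<Rightarrow> bool"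
  where "has_matrix_derivative F D z \<longleftrightarrow>
    (\<forall>i j. ((\<lambda>z. F z $ i $ j) has_field_derivative D $ i $ j) (at z))"

lemma has_matrix_derivative_const: "has_matrix_derivative (\<lambda>z. M) 0 z"
  by (auto simp: has_matrix_derivative_def)

lemma has_matrix_derivative_mult:
  assumes "has_matrix_derivative F F' z" "has_matrix_derivative G G' z"
  shows "has_matrix_derivative (\<lambda>z. F z ** G z) (F' ** G z + F z ** G') z"
  unfolding has_matrix_derivative_def
proof (intro allI)
  fix i j
  have "((\<lambda>z. \<Sum>k\<in>UNIV. F z $ i $ k * G z $ k $ j) has_field_derivative
      (\<Sum>k\<in>UNIV. F' $ i $ k * G z $ k $ j + G' $ k $ j * F z $ i $ k)) (at z)"
    using assms unfolding has_matrix_derivative_def by (intro DERIV_sum DERIV_mult) auto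
  then show "((\<lambda>z. (F z ** G z) $ i $ j) has_field_derivative (F' ** G z + F z ** G') $ i $ j) (at z)"
    by (simp add: matrix_matrix_mult_def sum.distrib mult.commute)
qed

lemma has_matrix_derivative_chain:
  assumes "has_matrix_derivative F F' (g z)" "(g has_field_derivative d) (at z)"
  shows "has_matrix_derivative (\<lambda>z. F (g z)) (d *\<^sub>M F') z"
  unfolding has_matrix_derivative_def
proof (intro allI)
  fix i j
  have "((\<lambda>z. F z $ i $ j) has_field_derivative F' $ i $ j) (at (g z))"
    using assms(1) unfolding has_matrix_derivative_def by blast
  from DERIV_chain2[OF this assms(2)]
  show "((\<lambda>z. F (g z) $ i $ j) has_field_derivative (d *\<^sub>M F') $ i $ j) (at z)"
    by (simp add: mult.commute)
qed

text \<open>The tool for the matrix identities below: a product expected to be constant in z is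
  differentiated, its derivative is seen to vanish, and its values at two points are
  compared.\<close>

lemma has_matrix_derivative_zero_constant:
  assumes "convex S" "\<And>z. z \<in> S \<Longrightarrow> has_matrix_derivative F 0 z" "x \<in> S" "y \<in> S"
  shows "F x = F y"
proof -
  have "F x $ i $ j = F y $ i $ j" for i j
  proof -
    have "((\<lambda>z. F z $ i $ j) has_field_derivative 0) (at z within S)" if "z \<in> S" for z
      using assms(2)[OF that] unfolding has_matrix_derivative_def
      by (auto intro: has_field_derivative_at_within)
    from has_field_derivative_zero_constant[OF assms(1) this] assms(3,4) show ?thesis
      by auto
  qed
  then show ?thesis by (simp add: vec_eq_iff)
qed

lemma continuous_on_matrix_derivative:
  assumes "\<And>z. z \<in> S \<Longrightarrow> has_matrix_derivative F (F' z) z"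
  shows "continuous_on S F"
proof -
  have "continuous_on S (\<lambda>z. \<chi> i j. F z $ i $ j)"
    using assms unfolding has_matrix_derivative_def
    by (intro continuous_on_vec_lambda continuous_at_imp_continuous_on ballI) (blast intro: DERIV_isCont)
  then show ?thesis by simp
qed

lemma has_matrix_derivative_mexp:
  "has_matrix_derivative (\<lambda>z. mexp (z *\<^sub>M M)) (mexp (z *\<^sub>M M) ** M) z"
  unfolding has_matrix_derivative_def
proof (intro allI)
  fix i j
  define c where "c i j n = mpow M n $ i $ j / fact n" for i j n
  have s: "(\<lambda>n. c i j n * y ^ n) sums (mexp (y *\<^sub>M M) $ i $ j)" for y i j
    unfolding c_def by (rule mexp_cscale_nth_sums)
  \<comment> \<open>The factor n + 1 from differentiation cancels against (n + 1)!, and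
    \<open>mpow\<close> multiplies by M on the right, so the differentiated series is the original
    one times M.\<close>
  have d: "diffs (c i j) n = (\<Sum>k\<in>UNIV. c i k n * M $ k $ j)" for n
  proof -
    have "diffs (c i j) n = mpow M (Suc n) $ i $ j / fact n"
      by (simp add: diffs_def c_def del: mpow.simps of_nat_Suc)
    also have "\<dots> = (\<Sum>k\<in>UNIV. c i k n * M $ k $ j)"
      by (simp add: matrix_matrix_mult_def c_def sum_divide_distrib)
    finally show ?thesis .
  qed
  have "(\<lambda>n. \<Sum>k\<in>UNIV. c i k n * z ^ n * M $ k $ j) sums (\<Sum>k\<in>UNIV. mexp (z *\<^sub>M M) $ i $ k * M $ k $ j)"
    by (intro sums_sum sums_mult2 s)
  then have "(\<lambda>n. diffs (c i j) n * z ^ n) sums ((mexp (z *\<^sub>M M) ** M) $ i $ j)"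
    by (simp add: d matrix_matrix_mult_def sum_distrib_left sum_distrib_right algebra_simps)
  moreover have "((\<lambda>y. \<Sum>n. c i j n * y ^ n) has_field_derivative (\<Sum>n. diffs (c i j) n * z ^ n)) (at z)"
    by (rule termdiffs_strong_converges_everywhere) (use s sums_summable in blast)
  ultimately show "((\<lambda>y. mexp (y *\<^sub>M M) $ i $ j) has_field_derivative (mexp (z *\<^sub>M M) ** M) $ i $ j) (at z)"
    by (simp add: sums_iff s[THEN sums_unique, symmetric])
qed

lemma mexp_0 [simp]: "mexp (0 :: 'r::finite cmat) = mat 1"
proof -
  have "mexp (0 :: 'r cmat) $ i $ j = mpow (0 :: 'r cmat) 0 $ i $ j / fact 0" for i j
    using sums_unique2[OF mexp_cscale_nth_sums[of 0 i j 0] powser_sums_zero] by simp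
  then show ?thesis by (simp add: vec_eq_iff)
qed

lemma mexp_commute:
  assumes "M ** N = N ** M"
  shows "mexp M ** N = N ** mexp M"
proof -
  have "(\<lambda>n. (1 / fact n) *\<^sub>R mpow M n ** N) sums (mexp M ** N)"
    by (rule bounded_linear.sums[OF bounded_bilinear.bounded_linear_left
          [OF bounded_bilinear_matrix_matrix_mult] mexp_sums])
  moreover have "(\<lambda>n. N ** (1 / fact n) *\<^sub>R mpow M n) sums (N ** mexp M)"
    by (rule bounded_linear.sums[OF bounded_bilinear.bounded_linear_right
          [OF bounded_bilinear_matrix_matrix_mult] mexp_sums])
  moreover have "(1 / fact n) *\<^sub>R mpow M n ** N = N ** (1 / fact n) *\<^sub>R mpow M n" for n
    using mpow_commute[OF assms, of n]
    by (simp add: bounded_bilinear.scaleR_left[OF bounded_bilinear_matrix_matrix_mult]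
        bounded_bilinear.scaleR_right[OF bounded_bilinear_matrix_matrix_mult])
  ultimately show ?thesis by (simp add: sums_unique2)
qed

text \<open>The product exp(zM) exp(-zM) has derivative zero, hence the same value at z = 1 as at z
  = 0.\<close>

lemma mexp_minus_right: "mexp M ** mexp (- M) = mat 1"
proof -
  define F where "F z = mexp (z *\<^sub>M M) ** mexp (z *\<^sub>M (- M))" for z
  have "has_matrix_derivative F 0 z" for z
  proof -
    have c: "mexp (z *\<^sub>M (- M)) ** M = M ** mexp (z *\<^sub>M (- M))"
      by (rule mexp_commute)
        (simp add: cscale_distribs matrix_mult_minus_left matrix_mult_minus_right)
    have "mexp (z *\<^sub>M M) ** M ** mexp (z *\<^sub>M (- M))
        + mexp (z *\<^sub>M M) ** (mexp (z *\<^sub>M (- M)) ** (- M)) = 0"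
      by (simp add: matrix_mult_minus_right c matrix_mul_assoc)
    with has_matrix_derivative_mult[OF has_matrix_derivative_mexp[of M z] has_matrix_derivative_mexp[of "- M" z]]
    show ?thesis unfolding F_def by simp
  qed
  then have "F 1 = F 0"
    by (intro has_matrix_derivative_zero_constant[of UNIV]) auto
  then show ?thesis by (simp add: F_def)
qed

text \<open>The product exp(zM) exp(zN) exp(-z(M + N)) has derivative zero, as M may be moved past
  exp(zN); at z = 1 it is therefore the identity. Multiplying by exp(M + N) on the right cancels the
  third factor.\<close>

lemma mexp_add:
  assumes "M ** N = N ** M"
  shows "mexp (M + N) = mexp M ** mexp N"
proof -
  define E where "E z = mexp (z *\<^sub>M (- (M + N)))" for z
  define F where "F z = mexp (z *\<^sub>M M) ** mexp (z *\<^sub>M N) ** E z" for z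
  have "has_matrix_derivative F 0 z" for z
  proof -
    have MN: "mexp (z *\<^sub>M N) ** M = M ** mexp (z *\<^sub>M N)"
      by (rule mexp_commute) (simp add: assms)
    have E: "E z ** (M + N) = (M + N) ** E z"
      unfolding E_def by (rule mexp_commute)
        (simp only: cscale_mult_left cscale_mult_right matrix_mult_minus_left matrix_mult_minus_right)
    have "(mexp (z *\<^sub>M M) ** M ** mexp (z *\<^sub>M N) + mexp (z *\<^sub>M M) ** (mexp (z *\<^sub>M N) ** N)) ** E z
        = mexp (z *\<^sub>M M) ** mexp (z *\<^sub>M N) ** ((M + N) ** E z)"
      by (simp add: matrix_add_ldistrib matrix_mult_add_left matrix_mul_assoc[symmetric])
        (simp add: matrix_mul_assoc MN)
    also have "\<dots> + mexp (z *\<^sub>M M) ** mexp (z *\<^sub>M N) ** (E z ** (- (M + N))) = 0"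
      by (simp only: matrix_mult_minus_right E add.right_inverse)
    finally show ?thesis
      using has_matrix_derivative_mult[OF has_matrix_derivative_mult
          [OF has_matrix_derivative_mexp[of M z] has_matrix_derivative_mexp[of N z]]
          has_matrix_derivative_mexp[of "- (M + N)" z]]
      unfolding F_def E_def by simp
  qed
  then have "F 1 = F 0"
    by (intro has_matrix_derivative_zero_constant[of UNIV]) auto
  then have inv: "mexp M ** mexp N ** mexp (- (M + N)) = mat 1"
    by (simp add: F_def E_def)
  have "mexp M ** mexp N ** (mexp (- (M + N)) ** mexp (- (- (M + N)))) = mexp (M + N)"
    unfolding matrix_mul_assoc inv by (simp only: matrix_mul_lid minus_minus)
  then show ?thesis by (simp only: mexp_minus_right matrix_mul_rid)
qed

lemma mexp_mat: "mexp (mat c :: 'a::finite cmat) = mat (exp c)"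
proof -
  have p: "mpow (mat 1) n = mat 1" for n
    by (induction n) auto
  have "mexp (c *\<^sub>M mat 1) $ i $ j = exp c * (mat 1 :: 'a cmat) $ i $ j" for i j :: 'a
  proof (rule sums_unique2)
    show "(\<lambda>n. (mat 1 :: 'a cmat) $ i $ j / fact n * c ^ n) sums (mexp (c *\<^sub>M mat 1) $ i $ j)"
      using mexp_cscale_nth_sums[of "mat 1" i j c] by (simp add: p)
    have "(\<lambda>n. c ^ n /\<^sub>R fact n * (mat 1 :: 'a cmat) $ i $ j) sums (exp c * (mat 1 :: 'a cmat) $ i $ j)"
      by (intro sums_mult2 exp_converges)
    then show "(\<lambda>n. (mat 1 :: 'a cmat) $ i $ j / fact n * c ^ n) sums (exp c * (mat 1 :: 'a cmat) $ i $ j)"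
      by (simp add: scaleR_conv_of_real[where 'a = complex] field_simps)
  qed
  then have "mexp (c *\<^sub>M (mat 1 :: 'a cmat)) = exp c *\<^sub>M mat 1"
    by (simp add: vec_eq_iff)
  then show ?thesis
    using mat_conv_cscale[of c, where ?'a = 'a] mat_conv_cscale[of "exp c", where ?'a = 'a] by simp
qed

lemma continuous_on_mexp_cscale [continuous_intros]:
  assumes "continuous_on S f"
  shows "continuous_on S (\<lambda>x. mexp (f x *\<^sub>M M))"
  by (rule continuous_on_compose2[OF continuous_on_matrix_derivative[of UNIV] assms])
    (auto intro: has_matrix_derivative_mexp)

section \<open>The binomial series\<close>

text \<open>Writing P(A + nI) as PA + nP avoids the norm of nI, which would bring in the norm of the
  identity once per factor. The bound is thus a scalar Pochhammer symbol, and a scalar binomial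
  series serves as majorant.\<close>

lemma norm_mpochhammer_le:
  "norm (mpochhammer A n) \<le> norm (mat 1 :: 'r::finite cmat) * pochhammer (norm (A :: 'r cmat)) n"
proof (induction n)
  case (Suc n)
  have "mpochhammer A (Suc n) = mpochhammer A n ** A + of_nat n *\<^sub>M mpochhammer A n"
    using mat_conv_cscale[of "of_nat n", where ?'a = 'r] by (simp add: matrix_add_ldistrib)
  also have "norm \<dots> \<le> norm (mpochhammer A n) * norm A + of_nat n * norm (mpochhammer A n)"
    by (rule norm_triangle_le) (simp add: norm_matrix_matrix_mult_le norm_cscale)
  also have "\<dots> = norm (mpochhammer A n) * (norm A + of_nat n)"
    by (simp add: algebra_simps)
  also have "\<dots> \<le> norm (mat 1 :: 'r cmat) * pochhammer (norm A) n * (norm A + of_nat n)"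
    by (intro mult_right_mono Suc) auto
  finally show ?case by (simp add: pochhammer_Suc algebra_simps)
qed simp

lemma pochhammer_binomial_sums:
  fixes a s :: real
  assumes "\<bar>s\<bar> < 1"
  shows "(\<lambda>n. pochhammer a n / fact n * s ^ n) sums (1 - s) powr (- a)"
  \<comment> \<open>The generalized binomial coefficient of -a carries a sign (-1)^n, which cancels
    that of (-s)^n.\<close>
  using gen_binomial_real[of "- s" "- a"] assms
  by (simp add: gbinomial_pochhammer power_mult_distrib[symmetric] flip: mult.assoc)
    (simp add: field_simps flip: power_mult_distrib)

lemma norm_mpochhammer_term_le:
  "norm ((x ^ n / fact n) *\<^sub>M mpochhammer A n)
     \<le> norm (mat 1 :: 'r::finite cmat) * (pochhammer (norm (A :: 'r cmat)) n / fact n * cmod x ^ n)"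
proof -
  have "norm ((x ^ n / fact n) *\<^sub>M mpochhammer A n) = (cmod x ^ n / fact n) * norm (mpochhammer A n)"
    by (simp add: norm_cscale norm_divide norm_power)
  also have "\<dots> \<le> (cmod x ^ n / fact n) * (norm (mat 1 :: 'r cmat) * pochhammer (norm A) n)"
    by (intro mult_left_mono norm_mpochhammer_le) auto
  finally show ?thesis by (simp add: field_simps)
qed

text \<open>The sum G of the series satisfies (1 - y) G' = G A, so G(y) exp(Ln(1 - y) A) has
  derivative zero on the unit disc; at y = 0 it is the identity.\<close>

lemma mbinomial_sums:
  assumes "cmod x < 1"
  shows "(\<lambda>n. (x ^ n / fact n) *\<^sub>M mpochhammer (A :: 'r::finite cmat) n) sums mcpow (1 - x) (- A)"
proof -
  define G where "G y = (\<Sum>n. (y ^ n / fact n) *\<^sub>M mpochhammer A n)" for y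
  define c where "c i j n = mpochhammer A n $ i $ j / fact n" for i j n
  have G: "(\<lambda>n. (y ^ n / fact n) *\<^sub>M mpochhammer A n) sums G y" if "cmod y < 1" for y
  proof -
    have "summable (\<lambda>n. norm (mat 1 :: 'r cmat) * (pochhammer (norm A) n / fact n * cmod y ^ n))"
      using pochhammer_binomial_sums[of "cmod y" "norm A"] that
      by (intro summable_mult) (auto simp: sums_iff)
    then have "summable (\<lambda>n. (y ^ n / fact n) *\<^sub>M mpochhammer A n)"
      by (rule summable_comparison_test'[where N = 0]) (rule norm_mpochhammer_term_le)
    then show ?thesis unfolding G_def by (rule summable_sums)
  qed
  have Gc: "(\<lambda>n. c i j n * y ^ n) sums (G y $ i $ j)" if "cmod y < 1" for y i j
  proof -
    have "bounded_linear (\<lambda>M :: 'r cmat. M $ i $ j)"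
      by (intro bounded_linear_compose[OF bounded_linear_vec_nth] bounded_linear_vec_nth)
    from bounded_linear.sums[OF this G[OF that]] show ?thesis
      by (simp add: c_def mult.commute)
  qed
  define G' where "G' y = (1 / (1 - y)) *\<^sub>M (G y ** A)" for y
  have deriv: "has_matrix_derivative G (G' y) y" if y: "cmod y < 1" for y
    unfolding has_matrix_derivative_def
  proof (intro allI)
    fix i j
    define D where "D = (\<Sum>n. diffs (c i j) n * y ^ n)"
    have D: "((\<lambda>y. \<Sum>n. c i j n * y ^ n) has_field_derivative D) (at y)"
      unfolding D_def by (rule termdiffs_strong'[OF _ y]) (use Gc sums_summable in blast)
    have sD: "summable (\<lambda>n. diffs (c i j) n * y ^ n)"
      by (rule termdiff_converges[OF y]) (use Gc sums_summable in blast)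
    \<comment> \<open>Coefficient form of the differential equation, from (A)_{n+1} = (A)_n A + n
      (A)_n.\<close>
    have rec: "diffs (c i j) n = (\<Sum>k\<in>UNIV. c i k n * A $ k $ j) + of_nat n * c i j n" for n
    proof -
      have "diffs (c i j) n = mpochhammer A (Suc n) $ i $ j / fact n"
        by (simp add: diffs_def c_def del: mpochhammer.simps of_nat_Suc)
      also have "mpochhammer A (Suc n) = mpochhammer A n ** A + of_nat n *\<^sub>M mpochhammer A n"
        using mat_conv_cscale[of "of_nat n", where ?'a = 'r] by (simp add: matrix_add_ldistrib)
      also have "\<dots> $ i $ j / fact n = (\<Sum>k\<in>UNIV. c i k n * A $ k $ j) + of_nat n * c i j n"
        by (simp add: matrix_matrix_mult_def c_def sum_divide_distrib add_divide_distrib)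
      finally show ?thesis .
    qed
    \<comment> \<open>\<open>diffs_equiv\<close> gives a series in y^(n - 1), and multiplication by
      y restores y^n; at n = 0 the factor n vanishes, so the truncated exponent does no harm. The
      outcome is D = (G A)_ij + y D, to be solved for D.\<close>
    have "(\<lambda>n. of_nat n * c i j n * y ^ (n - Suc 0)) sums D"
      unfolding D_def by (rule diffs_equiv[OF sD])
    then have "(\<lambda>n. y * (of_nat n * c i j n * y ^ (n - Suc 0))) sums (y * D)"
      by (rule sums_mult)
    moreover have "y * (of_nat n * c i j n * y ^ (n - Suc 0)) = of_nat n * c i j n * y ^ n" for n
      by (cases n) (auto simp: algebra_simps)
    ultimately have "(\<lambda>n. of_nat n * c i j n * y ^ n) sums (y * D)"
      by simp
    moreover have "(\<lambda>n. \<Sum>k\<in>UNIV. c i k n * y ^ n * A $ k $ j) sums (\<Sum>k\<in>UNIV. G y $ i $ k * A $ k $ j)"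
      by (intro sums_sum sums_mult2 Gc y)
    ultimately have "(\<lambda>n. (\<Sum>k\<in>UNIV. c i k n * y ^ n * A $ k $ j) + of_nat n * c i j n * y ^ n)
        sums ((\<Sum>k\<in>UNIV. G y $ i $ k * A $ k $ j) + y * D)"
      by (intro sums_add)
    moreover have "(\<Sum>k\<in>UNIV. c i k n * y ^ n * A $ k $ j) + of_nat n * c i j n * y ^ n
        = diffs (c i j) n * y ^ n" for n
      by (simp add: rec sum_distrib_left sum_distrib_right algebra_simps)
    ultimately have "D = (\<Sum>k\<in>UNIV. G y $ i $ k * A $ k $ j) + y * D"
      unfolding D_def by (simp add: sums_iff)
    moreover have "1 - y \<noteq> 0" using y by auto
    ultimately have "D = G' y $ i $ j"
      by (simp add: G'_def matrix_matrix_mult_def field_simps)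
    moreover have "((\<lambda>y. G y $ i $ j) has_field_derivative D) (at y)"
    proof (rule has_field_derivative_transform_within[OF D])
      \<comment> \<open>The series represents G only inside the unit disc; 1 - |y| is the distance
        from y to its boundary.\<close>
      show "0 < 1 - cmod y" using y by simp
      fix y' assume "dist y' y < 1 - cmod y"
      then have "cmod y' < 1"
        using norm_triangle_sub[of y' y] by (simp add: dist_norm)
      then show "(\<Sum>n. c i j n * y' ^ n) = G y' $ i $ j"
        using Gc by (simp add: sums_iff)
    qed simp
    ultimately show "((\<lambda>y. G y $ i $ j) has_field_derivative G' y $ i $ j) (at y)" by simp
  qed
  define F where "F y = G y ** mexp (Ln (1 - y) *\<^sub>M A)" for y
  have F: "has_matrix_derivative F 0 y" if "y \<in> ball 0 1" for y
  proof -
    have y: "cmod y < 1" using that by simp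
    \<comment> \<open>The right half-plane avoids the branch cut of \<open>Ln\<close>.\<close>
    then have "Re (1 - y) > 0" using abs_Re_le_cmod[of y] by auto
    then have "((\<lambda>y. Ln (1 - y)) has_field_derivative (- 1 / (1 - y))) (at y)"
      by (auto intro!: derivative_eq_intros simp: complex_nonpos_Reals_iff divide_inverse)
    from has_matrix_derivative_mult[OF deriv[OF y]
        has_matrix_derivative_chain[OF has_matrix_derivative_mexp this, of A]]
    have "has_matrix_derivative F (G' y ** mexp (Ln (1 - y) *\<^sub>M A)
        + G y ** ((- 1 / (1 - y)) *\<^sub>M (mexp (Ln (1 - y) *\<^sub>M A) ** A))) y"
      unfolding F_def .
    moreover have "mexp (Ln (1 - y) *\<^sub>M A) ** A = A ** mexp (Ln (1 - y) *\<^sub>M A)"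
      by (rule mexp_commute) simp
    ultimately show ?thesis
      by (simp add: G'_def matrix_mul_assoc cscale_distribs matrix_mult_minus_right)
  qed
  have "F x = F 0"
    by (rule has_matrix_derivative_zero_constant[of "ball 0 1"]) (use assms F in auto)
  moreover have "G 0 = mat 1"
  proof -
    have "G 0 $ i $ j = c i j 0" for i j
      using sums_unique2[OF Gc[of 0 i j] powser_sums_zero] by simp
    then show ?thesis by (simp add: vec_eq_iff c_def)
  qed
  ultimately have "G x ** mexp (Ln (1 - x) *\<^sub>M A) = mat 1"
    by (simp add: F_def)
  then have "mexp (- (Ln (1 - x) *\<^sub>M A))
      = (G x ** mexp (Ln (1 - x) *\<^sub>M A)) ** mexp (- (Ln (1 - x) *\<^sub>M A))"
    by simp
  also have "\<dots> = G x"
    unfolding matrix_mul_assoc[symmetric] mexp_minus_right by simp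
  finally show ?thesis
    using G[OF assms] by (simp add: mcpow_def cscale_distribs)
qed

section \<open>Exponential decay for positive stable matrices\<close>

definition poly_matrix :: "complex poly \<Rightarrow> 'r::finite cmat \<Rightarrow> 'r cmat"
  where "poly_matrix p M = (\<Sum>i\<le>degree p. coeff p i *\<^sub>M mpow M i)"

lemma poly_matrix_altdef:
  "degree p \<le> n \<Longrightarrow> poly_matrix p M = (\<Sum>i\<le>n. coeff p i *\<^sub>M mpow M i)"
  unfolding poly_matrix_def by (rule sum.mono_neutral_left) (auto simp: coeff_eq_0)

text \<open>On coefficients, multiplication by x - l is a shift, here \<open>pCons 0 q\<close>,
  minus l times q. The factor comes out on the right, where it can be absorbed into \<open>V\<close>
  in \<open>mexp_decay_aux\<close>.\<close>

lemma poly_matrix_linear_factor: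
  "poly_matrix ([:- l, 1:] * q) M = poly_matrix q M ** (M - mat l)"
proof -
  let ?n = "degree q"
  have "degree ([:- l, 1:] * q) \<le> Suc ?n"
    using degree_mult_le[of "[:- l, 1:]" q] by simp
  from poly_matrix_altdef[OF this, of M]
  have "poly_matrix ([:- l, 1:] * q) M
      = (\<Sum>i\<le>Suc ?n. coeff (pCons 0 q) i *\<^sub>M mpow M i) - (\<Sum>i\<le>Suc ?n. l *\<^sub>M coeff q i *\<^sub>M mpow M i)"
    by (simp add: cscale_distribs sum_subtractf del: sum.atMost_Suc)
  also have "(\<Sum>i\<le>Suc ?n. coeff (pCons 0 q) i *\<^sub>M mpow M i) = poly_matrix q M ** M"
    by (subst sum.atMost_Suc_shift) (simp add: poly_matrix_def matrix_mult_sum_left)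
  also have "(\<Sum>i\<le>Suc ?n. l *\<^sub>M coeff q i *\<^sub>M mpow M i) = l *\<^sub>M poly_matrix q M"
    unfolding poly_matrix_altdef[OF le_SucI[OF order_refl]]
    by (rule linear_sum[OF bounded_linear.linear[OF bounded_linear_cscale], symmetric])
  also have "poly_matrix q M ** M - l *\<^sub>M poly_matrix q M = poly_matrix q M ** (M - mat l)"
    using mat_conv_cscale[of l, where ?'a = 'a]
    by (simp add: bounded_bilinear.diff_right[OF bounded_bilinear_matrix_matrix_mult])
  finally show ?thesis .
qed

text \<open>Square matrices form a finite-dimensional real space, so the powers of M satisfy a
  nontrivial linear relation; its coefficients are those of p.\<close>

lemma exists_annihilating_poly:
  fixes M :: "'r::finite cmat"
  obtains p where "p \<noteq> 0" "poly_matrix p M = 0"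
proof -
  obtain T u k where T: "finite T" "k \<in> T" "u k \<noteq> (0 :: real)" "(\<Sum>i\<in>T. u i *\<^sub>R mpow M i) = 0"
  proof (cases "inj (mpow M)")
    \<comment> \<open>\<open>dependent\<close> speaks of the set of powers, which does not see
      repetitions; two coinciding powers give a relation with coefficients 1 and -1
      directly.\<close>
    case False
    then obtain i j where ij: "i \<noteq> j" "mpow M i = mpow M j"
      by (auto simp: inj_def)
    show ?thesis
      by (rule that[of "{i, j}" i "\<lambda>k. if k = i then 1 else - 1"]) (use ij in auto)
  next
    case True
    then have "dependent (range (mpow M))"
      using independent_bound finite_imageD by blast
    then obtain S v w where S: "finite S" "S \<subseteq> range (mpow M)" "(\<Sum>N\<in>S. v N *\<^sub>R N) = 0" "w \<in> S" "v w \<noteq> 0"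
      unfolding dependent_explicit by blast
    then obtain T where T: "finite T" "S = mpow M ` T"
      by (meson finite_subset_image)
    have "(\<Sum>N\<in>S. v N *\<^sub>R N) = (\<Sum>i\<in>T. v (mpow M i) *\<^sub>R mpow M i)"
      unfolding T(2) by (subst sum.reindex) (use True in \<open>auto intro: inj_on_subset\<close>)
    with S T that[of T _ "\<lambda>i. v (mpow M i)"] show ?thesis by auto
  qed
  define p where "p = (\<Sum>i\<in>T. monom (complex_of_real (u i)) i)"
  have c: "coeff p i = (if i \<in> T then of_real (u i) else 0)" for i
    using T(1) by (simp add: p_def coeff_sum sum.delta)
  have "p \<noteq> 0"
    using c[of k] T by auto
  moreover have "poly_matrix p M = 0"
  proof -
    obtain n where n: "degree p \<le> n" "T \<subseteq> {..n}"
      using finite_nat_set_iff_bounded_le[of T] T(1)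
      by (metis atMost_iff le_trans nle_le subsetI)
    have "poly_matrix p M = (\<Sum>i\<le>n. coeff p i *\<^sub>M mpow M i)"
      by (rule poly_matrix_altdef[OF n(1)])
    also have "\<dots> = (\<Sum>i\<in>T. u i *\<^sub>R mpow M i)"
      by (rule sum.mono_neutral_cong_right) (use n in \<open>auto simp: c cscale_of_real\<close>)
    finally show ?thesis using T by simp
  qed
  ultimately show ?thesis using that by blast
qed

lemma poly_matrix_const:
  assumes "degree p = 0"
  shows "poly_matrix p M = coeff p 0 *\<^sub>M mat 1"
  using assms by (simp add: poly_matrix_def)

lemma norm_le_if_entries_le:
  assumes "\<And>i j. cmod (M $ i $ j) \<le> K"
  shows "norm (M :: 'r::finite cmat) \<le> real (CARD('r) * CARD('r)) * K"
proof -
  have "norm (M $ i) \<le> real CARD('r) * K" for i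
  proof -
    have "norm (M $ i) \<le> (\<Sum>j\<in>UNIV. cmod (M $ i $ j))"
      unfolding norm_vec_def by (rule L2_set_le_sum) simp
    also have "\<dots> \<le> of_nat CARD('r) * K"
      by (rule sum_bounded_above) (rule assms)
    finally show ?thesis by simp
  qed
  then have "(\<Sum>i\<in>UNIV. norm (M $ i)) \<le> of_nat CARD('r) * (real CARD('r) * K)"
    by (intro sum_bounded_above) auto
  moreover have "norm M \<le> (\<Sum>i\<in>UNIV. norm (M $ i))"
    unfolding norm_vec_def[of M] by (rule L2_set_le_sum) simp
  ultimately show ?thesis by (simp add: algebra_simps)
qed

text \<open>A root \<open>l\<close> of \<open>p\<close> is split off: the induction hypothesis applies to \<open>W = (X - l) V\<close>. If \<open>l\<close> is
  not an eigenvalue, then \<open>X - l\<close> can be cancelled; otherwise \<open>exp (t l) exp (- t X) V\<close> has derivative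
  \<open>- exp (t l) exp (- t X) W\<close>, which is integrated.\<close>

lemma mexp_decay_aux:
  fixes X V :: "'r::finite cmat"
  assumes "positive_stable X" "p \<noteq> 0" "poly_matrix p X ** V = 0"
  shows "\<exists>\<delta>>0. \<exists>C. \<forall>t\<ge>0. norm (mexp (of_real t *\<^sub>M (- X)) ** V) \<le> C * exp (- \<delta> * t)"
  using assms(2,3)
proof (induction "degree p" arbitrary: p V)
  case 0
  then have "coeff p 0 \<noteq> 0" by (metis leading_coeff_0_iff)
  moreover have "coeff p 0 *\<^sub>M V = 0"
    using 0 by (simp add: poly_matrix_const)
  ultimately have "(1 / coeff p 0) *\<^sub>M coeff p 0 *\<^sub>M V = 0" "coeff p 0 \<noteq> 0"
    by simp_all
  then have "V = 0" by simp
  then have "\<forall>t\<ge>0. norm (mexp (of_real t *\<^sub>M (- X)) ** V) \<le> 0 * exp (- 1 * t)"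
    by simp
  then show ?case using zero_less_one by blast
next
  case (Suc n)
  from Suc.hyps(2) have "\<not> constant (poly p)"
    by (simp add: constant_degree)
  then obtain l where "poly p l = 0"
    using fundamental_theorem_of_algebra by blast
  then obtain q where p: "p = [:- l, 1:] * q"
    using poly_eq_0_iff_dvd by blast
  with Suc.prems have "q \<noteq> 0" by auto
  with p have "degree p = Suc (degree q)"
    using degree_mult_eq[of "[:- l, 1:]" q] by simp
  with Suc.hyps(2) have "n = degree q" by simp
  define W where "W = (X - mat l) ** V"
  have "poly_matrix q X ** W = 0"
    using Suc.prems(2) by (simp only: p poly_matrix_linear_factor W_def matrix_mul_assoc)
  from Suc.hyps(1)[OF \<open>n = degree q\<close> \<open>q \<noteq> 0\<close> this] obtain d0 C
    where d0: "d0 > 0" and C: "\<And>t. t \<ge> 0 \<Longrightarrow> norm (mexp (of_real t *\<^sub>M (- X)) ** W) \<le> C * exp (- d0 * t)"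
    by blast
  have C0: "C \<ge> 0" using C[of 0] order_trans[OF norm_ge_zero[of W]] by simp
  have comm: "mexp (c *\<^sub>M (- X)) ** (X - mat l) = (X - mat l) ** mexp (c *\<^sub>M (- X))" for c
  proof (rule mexp_commute)
    have "X ** (X - mat l) = (X - mat l) ** X"
      using mat_conv_cscale[of l, where ?'a = 'r]
      by (simp add: bounded_bilinear.diff_right[OF bounded_bilinear_matrix_matrix_mult]
          bounded_bilinear.diff_left[OF bounded_bilinear_matrix_matrix_mult])
    then show "c *\<^sub>M (- X) ** (X - mat l) = (X - mat l) ** c *\<^sub>M (- X)"
      by (simp add: matrix_mult_minus_left matrix_mult_minus_right)
  qed
  show ?case
  proof (cases "is_eigenvalue X l")
    case False
    have "(X - mat l) *v x = X *v x - l *s x" for x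
    proof -
      have "mat l *v x = l *s x"
        by (simp add: vec_eq_iff matrix_vector_mult_def mat_def mult_delta_left)
      then show ?thesis by (simp add: matrix_vector_mult_diff_rdistrib)
    qed
    then have "(X - mat l) *v x = 0 \<longrightarrow> x = 0" for x
      using False by (auto simp: is_eigenvalue_def)
    then obtain Y where Y: "Y ** (X - mat l) = mat 1"
      using matrix_left_invertible_ker by metis
    have "norm (mexp (of_real t *\<^sub>M (- X)) ** V) \<le> (norm Y * C) * exp (- d0 * t)" if "t \<ge> 0" for t
    proof -
      have "mexp (of_real t *\<^sub>M (- X)) ** V = Y ** ((X - mat l) ** mexp (of_real t *\<^sub>M (- X))) ** V"
        by (simp only: matrix_mul_assoc Y matrix_mul_lid)
      also have "\<dots> = Y ** (mexp (of_real t *\<^sub>M (- X)) ** W)"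
        by (simp only: comm[symmetric] W_def matrix_mul_assoc)
      also have "norm \<dots> \<le> norm Y * norm (mexp (of_real t *\<^sub>M (- X)) ** W)"
        by (rule norm_matrix_matrix_mult_le)
      also have "\<dots> \<le> norm Y * (C * exp (- d0 * t))"
        by (intro mult_left_mono C that) auto
      finally show ?thesis by simp
    qed
    with d0 show ?thesis by blast
  next
    case True
    with assms(1) have l: "Re l > 0" by (simp add: positive_stable_def)
    \<comment> \<open>\<open>d\<close> is at most the rate \<open>d0\<close> inherited from
      \<open>W\<close> and strictly below Re l. Thus \<open>a\<close> is positive, and the
      derivative of each entry of \<open>f\<close> at real t >= 0 is bounded by C exp(a t), whose
      primitive \<open>g\<close> has the same growth.\<close>
    define d where "d = min d0 (Re l / 2)"
    define a where "a = Re l - d"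
    have d: "d > 0" "d \<le> d0" and a: "a > 0" using d0 l by (auto simp: d_def a_def)
    define f where "f z = mexp (z *\<^sub>M (mat l - X)) ** V" for z
    have split: "mexp (z *\<^sub>M (mat l - X)) = exp (z * l) *\<^sub>M mexp (z *\<^sub>M (- X))" for z
    proof -
      have "z *\<^sub>M (mat l - X) = mat (z * l) + z *\<^sub>M (- X)"
        by (simp add: vec_eq_iff mat_def algebra_simps)
      also have "mexp \<dots> = mexp (mat (z * l)) ** mexp (z *\<^sub>M (- X))"
        using mat_conv_cscale[of "z * l", where ?'a = 'r] by (intro mexp_add) (simp add: mult_ac)
      also have "\<dots> = exp (z * l) *\<^sub>M mexp (z *\<^sub>M (- X))"
        using mat_conv_cscale[of "exp (z * l)", where ?'a = 'r] by (simp add: mexp_mat)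
      finally show ?thesis .
    qed
    have df: "has_matrix_derivative f (- (exp (z * l) *\<^sub>M (mexp (z *\<^sub>M (- X)) ** W))) z" for z
    proof -
      have "mexp (z *\<^sub>M (mat l - X)) ** (mat l - X) ** V + mexp (z *\<^sub>M (mat l - X)) ** 0
          = - (exp (z * l) *\<^sub>M (mexp (z *\<^sub>M (- X)) ** W))"
        using matrix_mult_minus_left[of "X - mat l" V]
        by (simp add: split W_def matrix_mult_minus_right cscale_distribs(5)[of _ "_ ** _"] flip: matrix_mul_assoc)
      with has_matrix_derivative_mult[OF has_matrix_derivative_mexp[of "mat l - X" z]
          has_matrix_derivative_const[of V z]]
      show ?thesis unfolding f_def by simp
    qed
    define g where "g t = C / a * exp (a * t)" for t
    have g: "(g has_real_derivative C * exp (a * t)) (at t within S)" for t S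
      unfolding g_def by (rule derivative_eq_intros refl)+ (use a in auto)
    have bound: "cmod (f (of_real t) $ i $ j) \<le> (norm V + C / a) * exp (a * t)" if "t \<ge> 0" for t i j
    proof (cases "t = 0")
      case True
      then show ?thesis
        using norm_nth_nth_le[of V i j] a C0 by (simp add: f_def add_increasing2)
    next
      case False
      with that have t: "0 < t" by simp
      define h where "h t = f (complex_of_real t) $ i $ j" for t
      define h' where "h' t = (- (exp (t * l) *\<^sub>M (mexp (t *\<^sub>M (- X)) ** W))) $ i $ j" for t
      have dh: "(h has_vector_derivative h' (of_real s)) (at s within S)" for s S
        unfolding h_def h'_def
        by (rule has_vector_derivative_real_field) (use df in \<open>simp add: has_matrix_derivative_def\<close>)
      have h': "norm (h' (of_real s)) \<le> C * exp (a * s)" if "s \<ge> 0" for s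
      proof -
        have "norm (h' (of_real s)) \<le> norm (exp (of_real s * l) *\<^sub>M (mexp (of_real s *\<^sub>M (- X)) ** W))"
          unfolding h'_def by (rule order_trans[OF norm_nth_nth_le]) simp
        also have "\<dots> \<le> exp (s * Re l) * (C * exp (- d0 * s))"
          unfolding norm_cscale norm_exp_eq_Re using C[OF that] by (auto intro: mult_left_mono)
        also have "\<dots> \<le> exp (s * Re l) * (C * exp (- d * s))"
          using d that C0 by (intro mult_left_mono) (auto intro: mult_right_mono)
        also have "\<dots> = C * exp (a * s)"
          by (simp add: a_def exp_add[symmetric] algebra_simps)
        finally show ?thesis .
      qed
      have "norm (h t - h 0) \<le> g t - g 0"
      proof (rule differentiable_bound_general[OF t])
        show "continuous_on {0..t} h"
          by (rule continuous_on_vector_derivative) (rule dh)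
        show "continuous_on {0..t} g"
          unfolding g_def by (intro continuous_intros)
        show "(h has_vector_derivative h' (of_real s)) (at s)" for s by (rule dh)
        show "(g has_vector_derivative C * exp (a * s)) (at s)" for s
          using g by (simp add: has_real_derivative_iff_has_vector_derivative)
        show "norm (h' (of_real s)) \<le> C * exp (a * s)" if "0 < s" for s
          using h' that by simp
      qed
      moreover have "norm (h 0) \<le> norm V"
        unfolding h_def f_def by (simp add: norm_nth_nth_le)
      moreover have "g 0 \<ge> 0" using C0 a by (simp add: g_def)
      moreover have "norm V \<le> norm V * exp (a * t)"
        using t a by (simp add: mult_le_cancel_left1)
      ultimately have "norm (h t) \<le> norm V * exp (a * t) + g t"
        using norm_triangle_sub[of "h t" "h 0"] by linarith
      then show ?thesis by (simp add: h_def g_def algebra_simps)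
    qed
    define K where "K = real (CARD('r) * CARD('r)) * (norm V + C / a)"
    have "norm (mexp (of_real t *\<^sub>M (- X)) ** V) \<le> K * exp (- d * t)" if "t \<ge> 0" for t
    proof -
      \<comment> \<open>The factor exp(t l) is undone: by the choice of \<open>a\<close>, exp(a t)
        exp(-t Re l) = exp(-d t).\<close>
      have "norm (exp (- (of_real t * l)) *\<^sub>M f (of_real t))
          \<le> exp (- (t * Re l)) * (real (CARD('r) * CARD('r)) * ((norm V + C / a) * exp (a * t)))"
        unfolding norm_cscale norm_exp_eq_Re
        using norm_le_if_entries_le[OF bound[OF that]] by (auto intro: mult_left_mono)
      also have "\<dots> = K * (exp (- (t * Re l)) * exp (a * t))"
        by (simp add: K_def)
      also have "exp (- (t * Re l)) * exp (a * t) = exp (- d * t)"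
        by (simp add: a_def exp_add[symmetric] algebra_simps)
      also have "exp (- (of_real t * l)) *\<^sub>M f (of_real t) = mexp (of_real t *\<^sub>M (- X)) ** V"
        by (simp add: f_def split mult_exp_exp)
      finally show ?thesis .
    qed
    with d show ?thesis by blast
  qed
qed

lemma mexp_decay:
  fixes X :: "'r::finite cmat"
  assumes "positive_stable X"
  obtains \<delta> C where "\<delta> > 0" "\<And>t. t \<ge> 0 \<Longrightarrow> norm (mexp (of_real t *\<^sub>M (- X))) \<le> C * exp (- \<delta> * t)"
proof -
  obtain p where "p \<noteq> 0" "poly_matrix p X = 0" by (rule exists_annihilating_poly)
  then have "\<exists>\<delta>>0. \<exists>C. \<forall>t\<ge>0. norm (mexp (of_real t *\<^sub>M (- X)) ** mat 1) \<le> C * exp (- \<delta> * t)"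
    by (intro mexp_decay_aux[OF assms, of p]) auto
  then show ?thesis using that by auto
qed

section \<open>The double binomial series\<close>

lemma pochhammer_nonneg_real: "(a :: real) \<ge> 0 \<Longrightarrow> pochhammer a n \<ge> 0"
  by (induction n) (auto simp: pochhammer_Suc)

text \<open>Lists the pairs by total degree N, on which alone the Pochhammer factor depends.\<close>

lemma bij_betw_antidiagonal:
  "bij_betw (\<lambda>(N, m). (m, N - m)) (SIGMA N:UNIV. {..N}) (UNIV :: (nat \<times> nat) set)"
  by (rule bij_betwI[where g = "\<lambda>(m, n). (m + n, m)"]) auto

lemma sum_binomial_fact:
  fixes x y :: "'a::field_char_0"
  shows "(\<Sum>m\<le>N. x ^ m * y ^ (N - m) / (fact m * fact (N - m))) = (x + y) ^ N / fact N"
  unfolding binomial_ring sum_divide_distrib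
  by (intro sum.cong) (auto simp: binomial_fact field_simps)

definition binomial_term :: "'r::finite cmat \<Rightarrow> complex \<Rightarrow> complex \<Rightarrow> nat \<times> nat \<Rightarrow> 'r cmat"
  where "binomial_term A x y = (\<lambda>(m, n). (x ^ m * y ^ n / (fact m * fact n)) *\<^sub>M mpochhammer A (m + n))"

text \<open>On each diagonal m + n = N the binomial theorem collapses the terms to (x + y)^N / N!
  times (A)_N, leaving the binomial series in x + y. The same grouping sums the majorant
  \<open>b\<close> made of absolute values, with \<open>norm A\<close> in place of A.\<close>

lemma
  fixes A :: "'r::finite cmat"
  assumes "cmod x + cmod y < 1"
  shows has_sum_binomial_term: "(binomial_term A x y has_sum mcpow (1 - x - y) (- A)) UNIV"
    and sum_norm_binomial_term_le: "finite F \<Longrightarrow>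
      (\<Sum>p\<in>F. norm (binomial_term A x y p))
        \<le> norm (mat 1 :: 'r cmat) * (1 - (cmod x + cmod y)) powr (- norm A)"
proof -
  let ?n1 = "norm (mat 1 :: 'r cmat)" and ?s = "cmod x + cmod y"
  define \<sigma> :: "nat \<times> nat \<Rightarrow> nat \<times> nat" where "\<sigma> = (\<lambda>(N, m). (m, N - m))"
  have \<sigma>: "bij_betw \<sigma> (SIGMA N:UNIV. {..N}) UNIV"
    unfolding \<sigma>_def by (rule bij_betw_antidiagonal)
  define b where "b = (\<lambda>(m, n). ?n1 * pochhammer (norm A) (m + n) * (cmod x ^ m * cmod y ^ n / (fact m * fact n)))"
  have b0: "b p \<ge> 0" for p
    by (auto simp: b_def pochhammer_nonneg_real split: prod.split)
  have le: "norm (binomial_term A x y p) \<le> b p" for p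
  proof (cases p)
    case (Pair m n)
    have "(cmod x ^ m * cmod y ^ n / (fact m * fact n)) * norm (mpochhammer A (m + n))
        \<le> (cmod x ^ m * cmod y ^ n / (fact m * fact n)) * (?n1 * pochhammer (norm A) (m + n))"
      by (intro mult_left_mono norm_mpochhammer_le) auto
    then show ?thesis
      by (simp add: Pair binomial_term_def b_def norm_cscale norm_divide norm_mult norm_power algebra_simps)
  qed
  have inner: "((\<lambda>m. b (\<sigma> (N, m))) has_sum (?n1 * (pochhammer (norm A) N / fact N * ?s ^ N))) {..N}" for N
  proof (rule has_sum_finiteI)
    have "(\<Sum>m\<le>N. b (\<sigma> (N, m))) = (\<Sum>m\<le>N. ?n1 * pochhammer (norm A) N *
        (cmod x ^ m * cmod y ^ (N - m) / (fact m * fact (N - m))))"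
      by (intro sum.cong) (auto simp: b_def \<sigma>_def)
    then show "?n1 * (pochhammer (norm A) N / fact N * ?s ^ N) = (\<Sum>m\<le>N. b (\<sigma> (N, m)))"
      by (simp only: sum_distrib_left[symmetric] sum_binomial_fact) simp
  qed simp
  have outer: "((\<lambda>N. ?n1 * (pochhammer (norm A) N / fact N * ?s ^ N)) has_sum ?n1 * (1 - ?s) powr (- norm A)) UNIV"
    using pochhammer_binomial_sums[of ?s "norm A"] assms
    by (intro sums_nonneg_imp_has_sum sums_mult) (auto simp: pochhammer_nonneg_real)
  have "(\<lambda>p. b (\<sigma> p)) summable_on (SIGMA N:UNIV. {..N})"
    by (rule summable_on_SigmaI[OF inner has_sum_imp_summable[OF outer] b0])
  then have "((\<lambda>p. b (\<sigma> p)) has_sum ?n1 * (1 - ?s) powr (- norm A)) (SIGMA N:UNIV. {..N})"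
    by (rule has_sum_SigmaI[OF inner outer])
  then have b: "(b has_sum ?n1 * (1 - ?s) powr (- norm A)) UNIV"
    using has_sum_reindex_bij_betw[OF \<sigma>] by blast
  show "(\<Sum>p\<in>F. norm (binomial_term A x y p)) \<le> ?n1 * (1 - ?s) powr (- norm A)" if "finite F"
  proof -
    have "(\<Sum>p\<in>F. norm (binomial_term A x y p)) \<le> (\<Sum>p\<in>F. b p)"
      by (intro sum_mono le)
    also have "\<dots> \<le> ?n1 * (1 - ?s) powr (- norm A)"
      by (rule finite_sum_le_has_sum[OF b that]) (auto simp: b0)
    finally show ?thesis .
  qed
  \<comment> \<open>Absolute convergence provides some sum \<open>S\<close> independent of the
    order; grouping by diagonals then identifies it.\<close>
  have "(\<lambda>p. norm (binomial_term A x y p)) summable_on UNIV"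
    by (rule summable_on_comparison_test[OF has_sum_imp_summable[OF b]]) (auto simp: le)
  then obtain S where S: "(binomial_term A x y has_sum S) UNIV"
    using abs_summable_summable unfolding summable_on_def by blast
  then have "((\<lambda>p. binomial_term A x y (\<sigma> p)) has_sum S) (SIGMA N:UNIV. {..N})"
    using has_sum_reindex_bij_betw[OF \<sigma>] by blast
  moreover have "((\<lambda>m. binomial_term A x y (\<sigma> (N, m))) has_sum
      ((x + y) ^ N / fact N) *\<^sub>M mpochhammer A N) {..N}" for N
  proof (rule has_sum_finiteI)
    have "(\<Sum>m\<le>N. binomial_term A x y (\<sigma> (N, m)))
        = (\<Sum>m\<le>N. (x ^ m * y ^ (N - m) / (fact m * fact (N - m))) *\<^sub>M mpochhammer A N)"
      by (intro sum.cong) (auto simp: binomial_term_def \<sigma>_def)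
    also have "\<dots> = (\<Sum>m\<le>N. x ^ m * y ^ (N - m) / (fact m * fact (N - m))) *\<^sub>M mpochhammer A N"
      by (simp add: vec_eq_iff sum_distrib_right)
    finally show "((x + y) ^ N / fact N) *\<^sub>M mpochhammer A N = (\<Sum>m\<le>N. binomial_term A x y (\<sigma> (N, m)))"
      by (simp add: sum_binomial_fact)
  qed simp
  ultimately have "((\<lambda>N. ((x + y) ^ N / fact N) *\<^sub>M mpochhammer A N) has_sum S) UNIV"
    by (rule has_sum_SigmaD)
  then have "(\<lambda>N. ((x + y) ^ N / fact N) *\<^sub>M mpochhammer A N) sums S"
    by (rule has_sum_imp_sums)
  moreover have "cmod (x + y) < 1"
    using norm_triangle_ineq[of x y] assms by linarith
  ultimately have "S = mcpow (1 - (x + y)) (- A)"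
    using mbinomial_sums sums_unique2 by blast
  with S show "(binomial_term A x y has_sum mcpow (1 - x - y) (- A)) UNIV"
    by (simp add: diff_diff_eq)
qed

section \<open>The beta kernel\<close>

text \<open>The integrand of \<open>ext_mBeta\<close> with the subtraction of the identity left to
  the arguments: exponents such as B - I and C - B - I are passed directly.\<close>

definition beta_kernel :: "'r::finite cmat \<Rightarrow> 'r cmat \<Rightarrow> 'r cmat \<Rightarrow> real \<Rightarrow> 'r cmat"
  where "beta_kernel P Q X t =
    mcpow (of_real t) P ** mcpow (of_real (1 - t)) Q ** mexp (- ((1 / (t * (1 - t))) *\<^sub>R X))"

lemma mcpow_of_real: "t > 0 \<Longrightarrow> mcpow (of_real t) M = mexp (of_real (ln t) *\<^sub>M M)"
  by (simp add: mcpow_def Ln_of_real)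

text \<open>As ln t is negative, the norm of (ln t) M is -(ln t) times that of M. The exponent is
  crude, but the exponential factor of the kernel outweighs any power.\<close>

lemma norm_mcpow_of_real_le:
  assumes "0 < t" "t < 1"
  shows "norm (mcpow (of_real t) M) \<le> norm (mat 1 :: 'r::finite cmat) * t powr (- norm (M :: 'r cmat))"
proof -
  have "norm (of_real (ln t) *\<^sub>M M) = - norm M * ln t"
    using assms by (simp add: norm_cscale)
  then show ?thesis
    using assms norm_mexp_le[of "of_real (ln t) *\<^sub>M M"] by (simp add: mcpow_of_real powr_def)
qed

text \<open>Turns the shift of B by mI in the beta factors into the scalar power u^m of the binomial
  expansion.\<close>

lemma mcpow_add_mat_of_nat:
  assumes "t > 0"
  shows "mcpow (of_real t) (M + mat (of_nat n)) = t ^ n *\<^sub>R mcpow (of_real t) M"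
proof -
  let ?l = "complex_of_real (ln t)"
  have "?l *\<^sub>M mat (of_nat n) = (mat (of_nat n * ?l) :: 'a cmat)"
    by (simp add: vec_eq_iff mat_def)
  then have "mcpow (of_real t) (M + mat (of_nat n)) = mexp (?l *\<^sub>M M + mat (of_nat n * ?l))"
    using assms by (simp add: mcpow_of_real cscale_distribs)
  also have "\<dots> = mexp (?l *\<^sub>M M) ** mexp (mat (of_nat n * ?l))"
    using mat_conv_cscale[of "of_nat n * ?l", where ?'a = 'a] by (intro mexp_add) (simp add: mult_ac)
  also have "\<dots> = exp (of_nat n * ?l) *\<^sub>M mexp (?l *\<^sub>M M)"
    using mat_conv_cscale[of "exp (of_nat n * ?l)", where ?'a = 'a] by (simp add: mexp_mat)
  also have "exp (of_nat n * ?l) = of_real (t ^ n)"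
    using assms by (simp add: exp_of_nat_mult exp_of_real)
  finally show ?thesis using assms by (simp only: cscale_of_real mcpow_of_real)
qed

lemma powr_times_exp_bounded:
  fixes p \<delta> :: real
  assumes "\<delta> > 0"
  obtains C where "C \<ge> 0" "\<And>x. x \<ge> 1 \<Longrightarrow> x powr p * exp (- \<delta> * x) \<le> C"
proof -
  \<comment> \<open>With a positive exponent, x^q exp(-delta x) has its maximum over positive x at q
    / delta. The bound claimed next is that maximum, obtained from ln y <= y - 1 at y = x delta /
    q.\<close>
  define q where "q = \<bar>p\<bar> + 1"
  have q: "q > 0" "p \<le> q" by (auto simp: q_def)
  have "x powr p * exp (- \<delta> * x) \<le> exp (q * ln (q / \<delta>) - q)" if x: "x \<ge> 1" for x
  proof -
    have "ln x = ln (x * \<delta> / q) + ln (q / \<delta>)"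
      using x q assms by (simp add: ln_mult ln_div)
    also have "ln (x * \<delta> / q) \<le> x * \<delta> / q - 1"
      using x q assms by (intro ln_le_minus_one) auto
    finally have "q * ln x \<le> q * (x * \<delta> / q - 1 + ln (q / \<delta>))"
      using q by (intro mult_left_mono) auto
    also have "\<dots> = \<delta> * x + (q * ln (q / \<delta>) - q)"
      using q by (simp add: algebra_simps)
    finally have "exp (q * ln x - \<delta> * x) \<le> exp (q * ln (q / \<delta>) - q)"
      by simp
    moreover have "x powr p \<le> x powr q"
      using x q by (intro powr_mono) auto
    then have "x powr p * exp (- \<delta> * x) \<le> x powr q * exp (- \<delta> * x)"
      by (rule mult_right_mono) simp
    moreover have "x powr q * exp (- \<delta> * x) = exp (q * ln x - \<delta> * x)"
      using x by (simp add: powr_def exp_add[symmetric])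
    ultimately show ?thesis by linarith
  qed
  then show ?thesis by (rule that[OF less_imp_le[OF exp_gt_zero]])
qed

text \<open>The singularities of the powers at both endpoints are absorbed by the exponential, because
  \<open>1 / (t * (1 - t)) = 1 / t + 1 / (1 - t)\<close>.\<close>

lemma beta_kernel_bounded:
  assumes "positive_stable X" "a \<ge> 0"
  obtains K where "K \<ge> 0"
    "\<And>t. 0 < t \<Longrightarrow> t < 1 \<Longrightarrow> norm (beta_kernel P Q X t) * (1 - t) powr (- a) \<le> (K :: real)"
proof -
  let ?n1 = "norm (mat 1 :: 'a cmat)"
  obtain d C where d: "d > 0"
    and C: "\<And>t. t \<ge> 0 \<Longrightarrow> norm (mexp (of_real t *\<^sub>M (- X))) \<le> C * exp (- d * t)"
    using mexp_decay[OF assms(1)] by metis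
  have C0: "C \<ge> 0" using C[of 0] order_trans[OF norm_ge_zero] by fastforce
  obtain C1 where C1: "C1 \<ge> 0" "\<And>x. x \<ge> 1 \<Longrightarrow> x powr norm P * exp (- d * x) \<le> C1"
    using powr_times_exp_bounded[OF d] by metis
  \<comment> \<open>The extra power (1 - t)^(-a) is charged to the endpoint t = 1 together with the
    power from \<open>Q\<close>; it makes room for the singularity of the binomial series.\<close>
  obtain C2 where C2: "C2 \<ge> 0" "\<And>x. x \<ge> 1 \<Longrightarrow> x powr (norm Q + a) * exp (- d * x) \<le> C2"
    using powr_times_exp_bounded[OF d] by metis
  have "norm (beta_kernel P Q X t) * (1 - t) powr (- a) \<le> ?n1 * ?n1 * C * (C1 * C2)"
    if t: "0 < t" "t < 1" for t
  proof -
    let ?r = "1 / (t * (1 - t))"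
    have r: "?r = 1 / t + 1 / (1 - t)" using t by (simp add: field_simps)
    have "- (?r *\<^sub>R X) = of_real ?r *\<^sub>M (- X)"
      unfolding cscale_of_real by simp
    then have 3: "norm (mexp (- (?r *\<^sub>R X))) \<le> C * exp (- d * ?r)"
      using C[of ?r] t by simp
    have "norm (beta_kernel P Q X t)
        \<le> norm (mcpow (of_real t) P) * norm (mcpow (of_real (1 - t)) Q) * norm (mexp (- (?r *\<^sub>R X)))"
      unfolding beta_kernel_def
      by (intro order_trans[OF norm_matrix_matrix_mult_le] mult_right_mono norm_matrix_matrix_mult_le) simp
    also have "\<dots> \<le> (?n1 * t powr (- norm P)) * (?n1 * (1 - t) powr (- norm Q)) * (C * exp (- d * ?r))"
      by (intro mult_mono 3 norm_mcpow_of_real_le) (use t in auto)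
    finally have "norm (beta_kernel P Q X t) * (1 - t) powr (- a)
      \<le> (?n1 * t powr (- norm P)) * (?n1 * (1 - t) powr (- norm Q)) * (C * exp (- d * ?r)) * (1 - t) powr (- a)"
      by (rule mult_right_mono) simp
    also have "\<dots> = ?n1 * ?n1 * C * (((1 / t) powr norm P * exp (- d * (1 / t)))
        * ((1 / (1 - t)) powr (norm Q + a) * exp (- d * (1 / (1 - t)))))"
    proof -
      have "exp (- d * ?r) = exp (- d * (1 / t)) * exp (- d * (1 / (1 - t)))"
        unfolding r by (simp add: exp_add[symmetric] algebra_simps)
      moreover have "(1 / t) powr norm P = t powr (- norm P)"
        using t by (simp add: powr_divide powr_minus_divide)
      moreover have "(1 / (1 - t)) powr (norm Q + a) = (1 - t) powr (- norm Q) * (1 - t) powr (- a)"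
        using t by (simp add: powr_divide powr_minus_divide powr_add)
      ultimately show ?thesis by simp
    qed
    also have "\<dots> \<le> ?n1 * ?n1 * C * (C1 * C2)"
      using t C0 C1(1) by (intro mult_left_mono mult_mono C1 C2) auto
    finally show ?thesis .
  qed
  then show ?thesis using that[of "?n1 * ?n1 * C * (C1 * C2)"] C0 C1(1) C2(1) by simp
qed

lemma continuous_on_beta_kernel: "continuous_on {0<..<1} (beta_kernel P Q X)"
proof -
  have cont: "continuous_on {0<..<1} (\<lambda>t. mexp (of_real (ln t) *\<^sub>M P) ** mexp (of_real (ln (1 - t)) *\<^sub>M Q)
      ** mexp (of_real (- (1 / (t * (1 - t)))) *\<^sub>M X))"
    by (intro continuous_intros) auto
  have eq: "beta_kernel P Q X t = mexp (of_real (ln t) *\<^sub>M P) ** mexp (of_real (ln (1 - t)) *\<^sub>M Q)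
      ** mexp (of_real (- (1 / (t * (1 - t)))) *\<^sub>M X)" if "t \<in> {0<..<1}" for t
    using that mcpow_of_real[of t P] mcpow_of_real[of "1 - t" Q]
    unfolding beta_kernel_def cscale_of_real by simp
  show ?thesis
    by (rule continuous_on_eq[OF cont]) (simp only: eq)
qed

section \<open>Termwise integration\<close>

text \<open>One integrable majorant of all partial sums of the norms bounds the partial sums of the
  integrated norms. These are therefore summable, which permits exchanging sum and integral.\<close>

lemma
  fixes f :: "nat \<Rightarrow> 'a \<Rightarrow> 'b::{banach, second_countable_topology}"
  assumes meas: "\<And>i. f i \<in> borel_measurable M" and g: "integrable M g"
    and bound: "\<And>n x. (\<Sum>i<n. norm (f i x)) \<le> g x"
  shows integrable_suminf_dominated: "integrable M (\<lambda>x. \<Sum>i. f i x)"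
    and has_sum_integral_dominated: "((\<lambda>i. integral\<^sup>L M (f i)) has_sum (\<integral>x. (\<Sum>i. f i x) \<partial>M)) UNIV"
proof -
  have fg: "norm (f i x) \<le> g x" for i x
  proof -
    have "norm (f i x) \<le> (\<Sum>i<Suc i. norm (f i x))"
      by (rule member_le_sum) auto
    also have "\<dots> \<le> g x" by (rule bound)
    finally show ?thesis .
  qed
  have int: "integrable M (f i)" for i
    by (rule Bochner_Integration.integrable_bound[OF g meas])
      (rule AE_I2, use fg[THEN order_trans[OF _ abs_ge_self]] in simp)
  have sn: "summable (\<lambda>i. norm (f i x))" for x
    by (rule summableI_nonneg_bounded[OF _ bound]) simp
  have si: "summable (\<lambda>i. \<integral>x. norm (f i x) \<partial>M)"
  proof (rule summableI_nonneg_bounded)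
    fix n
    have "(\<Sum>i<n. \<integral>x. norm (f i x) \<partial>M) = (\<integral>x. (\<Sum>i<n. norm (f i x)) \<partial>M)"
      using int by (intro Bochner_Integration.integral_sum[symmetric]) auto
    also have "\<dots> \<le> integral\<^sup>L M g"
      using int by (intro integral_mono g bound Bochner_Integration.integrable_sum) auto
    finally show "(\<Sum>i<n. \<integral>x. norm (f i x) \<partial>M) \<le> integral\<^sup>L M g" .
  qed simp
  show "integrable M (\<lambda>x. \<Sum>i. f i x)"
    by (rule integrable_suminf[OF int _ si]) (simp add: sn)
  have "(\<lambda>i. integral\<^sup>L M (f i)) sums (\<integral>x. (\<Sum>i. f i x) \<partial>M)"
    by (rule sums_integral[OF int _ si]) (simp add: sn)
  \<comment> \<open>Absolute convergence upgrades \<open>sums\<close> to \<open>has_sum\<close>, so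
    that the indices may later be rearranged into pairs.\<close>
  moreover have "summable (\<lambda>i. norm (integral\<^sup>L M (f i)))"
    by (rule summable_comparison_test'[OF si, where N = 0]) simp
  ultimately show "((\<lambda>i. integral\<^sup>L M (f i)) has_sum (\<integral>x. (\<Sum>i. f i x) \<partial>M)) UNIV"
    by (intro norm_summable_imp_has_sum)
qed

section \<open>Expanding the integrand of the Appell function\<close>

lemma mexp_commute_mexp:
  assumes "M ** N = N ** M"
  shows "mexp M ** mexp N = mexp N ** mexp M"
  using mexp_commute[OF mexp_commute[OF assms, symmetric]] by simp

lemma cscale_commute: "M ** N = N ** M \<Longrightarrow> (c *\<^sub>M M) ** (d *\<^sub>M N) = (d *\<^sub>M N) ** (c *\<^sub>M M)"
  by (simp add: mult.commute)

lemma ext_mBeta_conv_beta_kernel: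
  "ext_mBeta (P + mat (of_nat n)) Q X
     = (LINT t|lborel. indicator {0<..<1} t *\<^sub>R (t ^ n *\<^sub>R beta_kernel (P - mat 1) (Q - mat 1) X t))"
  unfolding ext_mBeta_def set_lebesgue_integral_def
proof (intro Bochner_Integration.integral_cong refl)
  fix t :: real
  show "indicator {0<..<1} t *\<^sub>R (mcpow (complex_of_real t) (P + mat (of_nat n) - mat 1)
      ** mcpow (complex_of_real (1 - t)) (Q - mat 1) ** mexp (- ((1 / (t * (1 - t))) *\<^sub>R X)))
    = indicator {0<..<1} t *\<^sub>R (t ^ n *\<^sub>R beta_kernel (P - mat 1) (Q - mat 1) X t)"
  proof (cases "t \<in> {0<..<1}")
    case True
    then have "mcpow (complex_of_real t) (P - mat 1 + mat (of_nat n)) = t ^ n *\<^sub>R mcpow (complex_of_real t) (P - mat 1)"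
      by (intro mcpow_add_mat_of_nat) simp
    moreover have "P + mat (of_nat n) - mat 1 = P - mat 1 + mat (of_nat n)"
      by simp
    ultimately show ?thesis
      by (simp only: beta_kernel_def bounded_bilinear.scaleR_left[OF bounded_bilinear_matrix_matrix_mult])
  qed simp
qed

lemma integrable_beta_kernel:
  assumes "positive_stable X"
  shows "integrable lborel (\<lambda>t. indicator {0<..<1} t *\<^sub>R (t ^ n *\<^sub>R beta_kernel P Q X t))"
proof -
  obtain K where K: "K \<ge> 0" "\<And>t. 0 < t \<Longrightarrow> t < 1 \<Longrightarrow> norm (beta_kernel P Q X t) * (1 - t) powr (- 0) \<le> K"
    using beta_kernel_bounded[OF assms order_refl] by metis
  show ?thesis
  proof (rule Bochner_Integration.integrable_bound)
    show "integrable lborel (\<lambda>t :: real. indicator {0<..<1} t *\<^sub>R K)"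
      by (intro integrable_scaleR_left integrable_real_indicator) auto
    show "(\<lambda>t. indicator {0<..<1} t *\<^sub>R (t ^ n *\<^sub>R beta_kernel P Q X t)) \<in> borel_measurable lborel"
      unfolding measurable_lborel1 measurable_lborel2
      by (intro borel_measurable_continuous_on_indicator continuous_intros continuous_on_beta_kernel) simp
    show "AE t in lborel. norm (indicator {0<..<1} t *\<^sub>R (t ^ n *\<^sub>R beta_kernel P Q X t))
        \<le> norm (indicator {0<..<1} t *\<^sub>R K)"
    proof (rule AE_I2)
      fix t :: real
      show "norm (indicator {0<..<1} t *\<^sub>R (t ^ n *\<^sub>R beta_kernel P Q X t)) \<le> norm (indicator {0<..<1} t *\<^sub>R K)"
      proof (cases "t \<in> {0<..<1}")
        case True
        then have "t ^ n * norm (beta_kernel P Q X t) \<le> 1 * norm (beta_kernel P Q X t)"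
          by (intro mult_right_mono power_le_one) auto
        with K True show ?thesis by fastforce
      qed simp
    qed
  qed
qed

lemma continuous_on_cscale [continuous_intros]:
  assumes "continuous_on S f"
  shows "continuous_on S (\<lambda>x. f x *\<^sub>M M)"
  unfolding cscale_def map_matrix_def by (intro continuous_intros continuous_on_vec_lambda assms)

section \<open>Term-by-term integration over the unit square\<close>

locale appell_kernel =
  fixes A B B' C C' X :: "complex ^ 'r ^ 'r" and z w :: complex
  assumes stable: "positive_stable X"
    and commute: "\<forall>M \<in> {B, B', C, C', X}. \<forall>N \<in> {B, B', C, C', X}. mcommute M N"
    and zw: "cmod z + cmod w \<le> 1"
begin

definition "k1 = beta_kernel (B - mat 1) (C - B - mat 1) X"
definition "k2 = beta_kernel (B' - mat 1) (C' - B' - mat 1) X"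
definition "S = {0<..<1::real} \<times> {0<..<1::real}"
definition "binom u v = mcpow (1 - z * of_real u - w * of_real v) (- A)"
text \<open>The indicator extends the term by zero to the plane. The factor with \<open>A\<close>
  stays on the left, as A is not assumed to commute with the other matrices.\<close>

definition "summand p = (\<lambda>(u, v). indicator S (u, v) *\<^sub>R
  (binomial_term A (z * of_real u) (w * of_real v) p ** k1 u ** k2 v))"

text \<open>Since |z| + |w| <= 1, the sum |z|u + |w|v is at most max(u, v), and 1 - max(u, v), the
  smaller of 1 - u and 1 - v, is at least their product. The product form separates the
  variables.\<close>

lemma cmod_lt_1:
  assumes "(u, v) \<in> S"
  shows "(1 - u) * (1 - v) \<le> 1 - (cmod (z * of_real u) + cmod (w * of_real v))"
    and "cmod (z * of_real u) + cmod (w * of_real v) < 1"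
proof -
  have uv: "0 < u" "u < 1" "0 < v" "v < 1" using assms by (auto simp: S_def)
  have "cmod z * u + cmod w * v \<le> cmod z * max u v + cmod w * max u v"
    by (intro add_mono mult_left_mono) auto
  also have "\<dots> = (cmod z + cmod w) * max u v"
    by (simp add: algebra_simps)
  also have "\<dots> \<le> 1 * max u v"
    using zw uv by (intro mult_right_mono) auto
  finally have 1: "cmod (z * of_real u) + cmod (w * of_real v) \<le> max u v"
    using uv by (simp add: norm_mult)
  have "(1 - u) * (1 - v) \<le> 1 * (1 - v)" "(1 - u) * (1 - v) \<le> (1 - u) * 1"
    using uv by (intro mult_right_mono mult_left_mono; simp)+
  then have "(1 - u) * (1 - v) \<le> 1 - max u v" by auto
  with 1 show "(1 - u) * (1 - v) \<le> 1 - (cmod (z * of_real u) + cmod (w * of_real v))"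
    by linarith
  show "cmod (z * of_real u) + cmod (w * of_real v) < 1"
    using 1 uv by auto
qed

lemma sum_norm_summand_bounded:
  obtains K where "\<And>F p. finite F \<Longrightarrow> (\<Sum>i\<in>F. norm (summand i p)) \<le> indicator S p *\<^sub>R (K :: real)"
proof -
  let ?n1 = "norm (mat 1 :: 'r cmat)"
  obtain K1 where K1: "K1 \<ge> 0" "\<And>t. 0 < t \<Longrightarrow> t < 1 \<Longrightarrow> norm (k1 t) * (1 - t) powr (- norm A) \<le> K1"
    using beta_kernel_bounded[OF stable norm_ge_zero] unfolding k1_def by metis
  obtain K2 where K2: "K2 \<ge> 0" "\<And>t. 0 < t \<Longrightarrow> t < 1 \<Longrightarrow> norm (k2 t) * (1 - t) powr (- norm A) \<le> K2"
    using beta_kernel_bounded[OF stable norm_ge_zero] unfolding k2_def by metis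
  have "(\<Sum>i\<in>F. norm (summand i p)) \<le> indicator S p *\<^sub>R (?n1 * K1 * K2)" if F: "finite F" for F p
  proof (cases p)
    case [simp]: (Pair u v)
    show ?thesis
    proof (cases "(u, v) \<in> S")
      case True
      then have uv: "0 < u" "u < 1" "0 < v" "v < 1" by (auto simp: S_def)
      let ?T = "binomial_term A (z * of_real u) (w * of_real v)"
      let ?s = "cmod (z * of_real u) + cmod (w * of_real v)"
      have "norm (summand i p) \<le> norm (?T i) * (norm (k1 u) * norm (k2 v))" for i
        using True order_trans[OF norm_matrix_matrix_mult_le mult_right_mono
            [OF norm_matrix_matrix_mult_le norm_ge_zero], of "?T i" "k1 u" "k2 v"]
        by (simp add: summand_def mult.assoc)
      then have "(\<Sum>i\<in>F. norm (summand i p)) \<le> (\<Sum>i\<in>F. norm (?T i)) * (norm (k1 u) * norm (k2 v))"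
        unfolding sum_distrib_right by (rule sum_mono)
      also have "\<dots> \<le> ?n1 * (1 - ?s) powr (- norm A) * (norm (k1 u) * norm (k2 v))"
        by (intro mult_right_mono sum_norm_binomial_term_le cmod_lt_1 True F) auto
      \<comment> \<open>The negative exponent reverses the inequality of \<open>cmod_lt_1\<close>;
        each of the two resulting powers is absorbed by the kernel in its own variable.\<close>
      also have "\<dots> \<le> ?n1 * ((1 - u) * (1 - v)) powr (- norm A) * (norm (k1 u) * norm (k2 v))"
        using uv cmod_lt_1[OF True]
        by (intro mult_right_mono mult_left_mono powr_mono2') auto
      also have "\<dots> = ?n1 * (norm (k1 u) * (1 - u) powr (- norm A)) * (norm (k2 v) * (1 - v) powr (- norm A))"
        using uv by (simp add: powr_mult)
      also have "\<dots> \<le> ?n1 * K1 * K2"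
        using uv K1 K2 by (intro mult_mono) auto
      finally show ?thesis using True by simp
    qed (simp add: summand_def)
  qed
  then show ?thesis using that by blast
qed

lemma continuous_on_k1: "continuous_on {0<..<1} k1" and continuous_on_k2: "continuous_on {0<..<1} k2"
  unfolding k1_def k2_def by (rule continuous_on_beta_kernel)+

lemma summand_measurable: "summand i \<in> borel_measurable (lborel \<Otimes>\<^sub>M lborel)"
proof -
  obtain m n where i: "i = (m, n)" by (cases i)
  have "continuous_on S (\<lambda>p. binomial_term A (z * of_real (fst p)) (w * of_real (snd p)) i ** k1 (fst p) ** k2 (snd p))"
    unfolding i binomial_term_def case_prod_conv
    by (intro continuous_intros continuous_on_compose2[OF continuous_on_k1]
        continuous_on_compose2[OF continuous_on_k2]) (auto simp: S_def)
  moreover have "S \<in> sets borel"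
    unfolding S_def by (intro borel_open open_Times) auto
  ultimately have "(\<lambda>p. indicator S p *\<^sub>R (binomial_term A (z * of_real (fst p)) (w * of_real (snd p)) i ** k1 (fst p) ** k2 (snd p)))
     \<in> borel_measurable borel"
    by (intro borel_measurable_continuous_on_indicator)
  then show ?thesis
    by (simp add: summand_def case_prod_beta' lborel_prod)
qed

text \<open>The term is a constant matrix times a function of u times a function of v, in this
  order. Integrating over v and then over u pulls the second integral out on the right and the
  constant out on the left, with no factors interchanged.\<close>

lemma summand_integral:
  assumes "integrable (lborel \<Otimes>\<^sub>M lborel) (summand i)"
  shows "integral\<^sup>L (lborel \<Otimes>\<^sub>M lborel) (summand i) = ext_F2_term A B B' C C' z w X i"
proof -
  obtain m n where i: "i = (m, n)" by (cases i)
  define g1 where "g1 = (\<lambda>u. indicator {0<..<1} u *\<^sub>R (u ^ m *\<^sub>R k1 u))"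
  define g2 where "g2 = (\<lambda>v. indicator {0<..<1} v *\<^sub>R (v ^ n *\<^sub>R k2 v))"
  define c where "c = z ^ m * w ^ n / (fact m * fact n)"
  have g: "integrable lborel g1" "integrable lborel g2"
    unfolding g1_def g2_def k1_def k2_def by (rule integrable_beta_kernel[OF stable])+
  have eq: "summand i (u, v) = ((c *\<^sub>M mpochhammer A (m + n)) ** g1 u) ** g2 v" for u v
  proof (cases "(u, v) \<in> S")
    case True
    then show ?thesis
      by (simp add: S_def summand_def i binomial_term_def g1_def g2_def c_def cscale_of_real[symmetric]
          power_mult_distrib mult_ac)
  qed (auto simp: S_def summand_def g1_def g2_def)
  have "integral\<^sup>L (lborel \<Otimes>\<^sub>M lborel) (summand i) = (LINT u|lborel. LINT v|lborel. summand i (u, v))"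
    by (rule lborel_pair.integral_fst'[symmetric, OF assms])
  also have "\<dots> = (LINT u|lborel. ((c *\<^sub>M mpochhammer A (m + n)) ** g1 u) ** integral\<^sup>L lborel g2)"
    unfolding eq
    by (intro Bochner_Integration.integral_cong refl integral_bounded_linear g
        bounded_bilinear.bounded_linear_right[OF bounded_bilinear_matrix_matrix_mult])
  also have "\<dots> = (LINT u|lborel. (c *\<^sub>M mpochhammer A (m + n)) ** g1 u) ** integral\<^sup>L lborel g2"
    by (intro integral_bounded_linear[OF bounded_bilinear.bounded_linear_left[OF bounded_bilinear_matrix_matrix_mult]]
       integrable_bounded_linear[OF bounded_bilinear.bounded_linear_right[OF bounded_bilinear_matrix_matrix_mult]] g)
  also have "(LINT u|lborel. (c *\<^sub>M mpochhammer A (m + n)) ** g1 u) = (c *\<^sub>M mpochhammer A (m + n)) ** integral\<^sup>L lborel g1"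
    by (rule integral_bounded_linear[OF bounded_bilinear.bounded_linear_right[OF bounded_bilinear_matrix_matrix_mult] g(1)])
  finally have "integral\<^sup>L (lborel \<Otimes>\<^sub>M lborel) (summand i)
      = (c *\<^sub>M mpochhammer A (m + n)) ** integral\<^sup>L lborel g1 ** integral\<^sup>L lborel g2" .
  moreover have "ext_mBeta (B + mat (of_nat m)) (C - B) X = integral\<^sup>L lborel g1"
    "ext_mBeta (B' + mat (of_nat n)) (C' - B') X = integral\<^sup>L lborel g2"
    unfolding g1_def g2_def k1_def k2_def by (rule ext_mBeta_conv_beta_kernel)+
  ultimately show ?thesis
    by (simp add: ext_F2_term_def i c_def)
qed

lemma has_sum_summand:
  assumes "p \<in> S"
  shows "((\<lambda>i. summand i p) has_sum (case p of (u, v) \<Rightarrow> binom u v ** k1 u ** k2 v)) UNIV"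
proof (cases p)
  case (Pair u v)
  have "bounded_linear (\<lambda>M :: 'r cmat. M ** k1 u ** k2 v)"
    by (intro bounded_linear_compose[OF bounded_bilinear.bounded_linear_left
       [OF bounded_bilinear_matrix_matrix_mult]]
       bounded_bilinear.bounded_linear_left[OF bounded_bilinear_matrix_matrix_mult])
  from has_sum_bounded_linear[OF this has_sum_binomial_term[of "z * of_real u" "w * of_real v" A]]
  show ?thesis
    using assms cmod_lt_1 by (simp add: Pair summand_def binom_def)
qed

definition "integrand u v = binom u v ** k1 u ** k2 v"

text \<open>\<open>prod_decode\<close> enumerates the pairs (m, n) for the dominated exchange over
  the naturals; as its outcome is a \<open>has_sum\<close>, it carries back to pairs. The majorant
  is constant on the square, which has finite measure.\<close>

lemma
  shows integrable_integrand: "integrable (lborel \<Otimes>\<^sub>M lborel) (\<lambda>(u, v). indicator S (u, v) *\<^sub>R integrand u v)"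
    and has_sum_ext_F2_term: "(ext_F2_term A B B' C C' z w X has_sum
      (\<integral>(u, v). indicator S (u, v) *\<^sub>R integrand u v \<partial>(lborel \<Otimes>\<^sub>M lborel))) UNIV"
proof -
  let ?M = "lborel \<Otimes>\<^sub>M lborel :: (real \<times> real) measure"
  obtain K where K: "\<And>F p. finite F \<Longrightarrow> (\<Sum>i\<in>F. norm (summand i p)) \<le> indicator S p *\<^sub>R (K :: real)"
    using sum_norm_summand_bounded by metis
  have bij: "bij prod_decode" by (rule bij_prod_decode)
  have S: "S \<in> sets ?M" "emeasure ?M S < \<infinity>"
    unfolding lborel_prod S_def
    using emeasure_bounded_finite[OF bounded_Times, of "{0<..<1 :: real}" "{0<..<1 :: real}"]
    by (auto intro!: borel_open open_Times)
  have intK: "integrable ?M (\<lambda>p. indicator S p *\<^sub>R K)"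
    using S by (intro integrable_scaleR_left integrable_real_indicator)
  have bound: "(\<Sum>i<n. norm (summand (prod_decode i) p)) \<le> indicator S p *\<^sub>R K" for n p
    using K[of "prod_decode ` {..<n}" p] by (simp add: sum.reindex inj_prod_decode)
  have suminf: "(\<Sum>i. summand (prod_decode i) p) = (case p of (u, v) \<Rightarrow> indicator S (u, v) *\<^sub>R integrand u v)" for p
  proof (cases "p \<in> S")
    case True
    have "((\<lambda>i. summand (prod_decode i) p) has_sum (case p of (u, v) \<Rightarrow> integrand u v)) UNIV"
      unfolding has_sum_reindex_bij_betw[OF bij, of "\<lambda>i. summand i p"] integrand_def by (rule has_sum_summand[OF True])
    then have "(\<lambda>i. summand (prod_decode i) p) sums (case p of (u, v) \<Rightarrow> integrand u v)"
      by (rule has_sum_imp_sums)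
    with True show ?thesis by (cases p) (simp add: sums_iff)
  qed (auto simp: summand_def split: prod.split)
  show "integrable ?M (\<lambda>(u, v). indicator S (u, v) *\<^sub>R integrand u v)"
    using integrable_suminf_dominated[where f = "\<lambda>i. summand (prod_decode i)", OF summand_measurable intK bound]
    by (simp only: suminf)
  have int: "integrable ?M (summand i)" for i
    by (rule Bochner_Integration.integrable_bound[OF intK summand_measurable])
      (rule AE_I2, use K[of "{i}", THEN order_trans[OF _ abs_ge_self]] in simp)
  have "((\<lambda>i. ext_F2_term A B B' C C' z w X (prod_decode i)) has_sum
      (\<integral>(u, v). indicator S (u, v) *\<^sub>R integrand u v \<partial>?M)) UNIV"
    using has_sum_integral_dominated[where f = "\<lambda>i. summand (prod_decode i)", OF summand_measurable intK bound]
    by (simp only: suminf summand_integral[OF int])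
  then show "(ext_F2_term A B B' C C' z w X has_sum
      (\<integral>(u, v). indicator S (u, v) *\<^sub>R integrand u v \<partial>?M)) UNIV"
    unfolding has_sum_reindex_bij_betw[OF bij] .
qed

lemma iterated_integral_integrand:
  "(\<integral>(u, v). indicator S (u, v) *\<^sub>R integrand u v \<partial>(lborel \<Otimes>\<^sub>M lborel))
     = (LINT v:{0<..<1}|lborel. LINT u:{0<..<1}|lborel. integrand u v)"
proof -
  have "(LINT u|lborel. indicator S (u, v) *\<^sub>R integrand u v)
      = indicator {0<..<1} v *\<^sub>R (LINT u|lborel. indicator {0<..<1} u *\<^sub>R integrand u v)" for v
    by (cases "v \<in> {0<..<1}") (auto simp: S_def indicator_times)
  then show ?thesis
    using lborel_pair.integral_snd[OF integrable_integrand]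
    unfolding set_lebesgue_integral_def by simp
qed

text \<open>Commutativity enters here: X commutes with B' and C', so exp(-X/(u(1 - u))) moves past
  the two powers in v and merges with the exponential in v.\<close>

lemma integrand_eq:
  assumes "0 < u" "u < 1" "0 < v" "v < 1"
  shows "integrand u v = mcpow (1 - z * of_real u - w * of_real v) (- A)
           ** mcpow (of_real u) (B - mat 1) ** mcpow (of_real (1 - u)) (C - B - mat 1)
           ** mcpow (of_real v) (B' - mat 1) ** mcpow (of_real (1 - v)) (C' - B' - mat 1)
           ** mexp (- ((1 / (u * (1 - u))) *\<^sub>R X) - (1 / (v * (1 - v))) *\<^sub>R X)"
proof -
  let ?X = "\<lambda>t. - ((1 / (t * (1 - t))) *\<^sub>R X)"
  note distribs = bounded_bilinear.diff_left[OF bounded_bilinear_matrix_matrix_mult]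
    bounded_bilinear.diff_right[OF bounded_bilinear_matrix_matrix_mult]
  have X: "?X t = of_real (- (1 / (t * (1 - t)))) *\<^sub>M X" for t
    unfolding cscale_of_real by simp
  have XC: "X ** B' = B' ** X" "X ** C' = C' ** X"
    using commute unfolding mcommute_def by blast+
  have XB: "X ** (B' - mat 1) = (B' - mat 1) ** X" "X ** (C' - B' - mat 1) = (C' - B' - mat 1) ** X"
    using XC by (simp_all add: distribs)
  have 1: "mexp (?X u) ** mcpow (of_real v) (B' - mat 1) = mcpow (of_real v) (B' - mat 1) ** mexp (?X u)"
    unfolding X mcpow_def by (intro mexp_commute_mexp cscale_commute XB)
  have 2: "mexp (?X u) ** mcpow (of_real (1 - v)) (C' - B' - mat 1) = mcpow (of_real (1 - v)) (C' - B' - mat 1) ** mexp (?X u)"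
    unfolding X mcpow_def by (intro mexp_commute_mexp cscale_commute XB)
  have 3: "mexp (?X u - (1 / (v * (1 - v))) *\<^sub>R X) = mexp (?X u) ** mexp (?X v)"
    unfolding diff_conv_add_uminus[of "?X u"]
    by (rule mexp_add) (simp only: X cscale_commute)
  have "mexp (?X u) ** k2 v = mcpow (of_real v) (B' - mat 1) ** mcpow (of_real (1 - v)) (C' - B' - mat 1)
      ** mexp (?X u - (1 / (v * (1 - v))) *\<^sub>R X)"
    unfolding 3 k2_def beta_kernel_def matrix_mul_assoc 1
    by (simp only: matrix_mul_assoc[symmetric] 2)
  then show ?thesis
    unfolding integrand_def binom_def k1_def beta_kernel_def
    by (simp only: matrix_mul_assoc[symmetric])
qed

end

text \<open>\<open>infsum\<close> and the Lebesgue integral take the value 0 where they do not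
  exist, so summability and integrability belong to the conclusion. The bound on |z| + |w| places zu
  + wv in the open unit disc for u and v in (0, 1), where the binomial series converges.\<close>

theorem theorem3p2:
  fixes A B B' C C' X :: "complex ^ 'r ^ 'r" and z w :: complex
  assumes "positive_stable A"
    and "positive_stable B" and "positive_stable B'"
    and "positive_stable C" and "positive_stable C'"
    and "positive_stable (C - B)" and "positive_stable (C' - B')"
    and "positive_stable X"
    and "\<forall>M \<in> {B, B', C, C', X}. \<forall>N \<in> {B, B', C, C', X}. mcommute M N"
    and "cmod z + cmod w \<le> 1"
  shows "let K = (\<lambda>u v :: real.
           mcpow (1 - z * of_real u - w * of_real v) (- A)
           ** mcpow (of_real u) (B - mat 1) ** mcpow (of_real (1 - u)) (C - B - mat 1)
           ** mcpow (of_real v) (B' - mat 1) ** mcpow (of_real (1 - v)) (C' - B' - mat 1)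
           ** mexp (- ((1 / (u * (1 - u))) *\<^sub>R X) - (1 / (v * (1 - v))) *\<^sub>R X))
         in ext_F2_term A B B' C C' z w X summable_on UNIV
          \<and> set_integrable lborel ({0<..<1} \<times> {0<..<1}) (\<lambda>(u, v). K u v)
          \<and> ext_F2 A B B' C C' z w X =
              (LINT v:{0<..<1}|lborel. LINT u:{0<..<1}|lborel. K u v)
              ** appell_factor B B' C C'"
proof -
  interpret appell_kernel A B B' C C' X z w
    by unfold_locales (fact assms)+
  define K where "K = (\<lambda>u v :: real.
           mcpow (1 - z * of_real u - w * of_real v) (- A)
           ** mcpow (of_real u) (B - mat 1) ** mcpow (of_real (1 - u)) (C - B - mat 1)
           ** mcpow (of_real v) (B' - mat 1) ** mcpow (of_real (1 - v)) (C' - B' - mat 1)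
           ** mexp (- ((1 / (u * (1 - u))) *\<^sub>R X) - (1 / (v * (1 - v))) *\<^sub>R X))"
  have K: "integrand u v = K u v" if "0 < u" "u < 1" "0 < v" "v < 1" for u v
    unfolding K_def by (rule integrand_eq[OF that])
  have "(\<lambda>(u, v). indicator S (u, v) *\<^sub>R integrand u v)
      = (\<lambda>p. indicator ({0<..<1} \<times> {0<..<1}) p *\<^sub>R (case p of (u, v) \<Rightarrow> K u v))"
    by (auto simp: S_def indicator_def K fun_eq_iff)
  then have "set_integrable lborel ({0<..<1} \<times> {0<..<1}) (\<lambda>(u, v). K u v)"
    using integrable_integrand unfolding set_integrable_def by (simp add: lborel_prod)
  moreover have "(LINT v:{0<..<1}|lborel. LINT u:{0<..<1}|lborel. integrand u v)
      = (LINT v:{0<..<1}|lborel. LINT u:{0<..<1}|lborel. K u v)"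
    by (intro set_lebesgue_integral_cong allI impI) (auto intro!: set_lebesgue_integral_cong simp: K)
  ultimately show ?thesis
    unfolding K_def[symmetric] Let_def ext_F2_def
    using has_sum_ext_F2_term iterated_integral_integrand
    by (auto simp: has_sum_imp_summable infsumI)
qed

end
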